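(* Let $\alpha:\mathbb{P}_{\mathbb N}\to\mathrm{Aut}(\mathfrak A)$ be a local action of the group $\mathbb{P}_{\mathbb N}$ of finite permutations of $\mathbb N$ on a quasi-local algebra $(\mathfrak A,\theta)$. If $\omega$ is an $\alpha$-invariant state on $\mathfrak A$, then: (1) $\omega$ is even, i.e. $\omega\circ\theta=\omega$; (2) $E_\omega\pi_\omega(\mathfrak A)E_\omega$ is a commuting family of operators; hence the dynamical system $(\mathfrak A,\mathbb{P}_{\mathbb N},\alpha)$ is $\mathbb{P}_{\mathbb N}$-abelian; (3) $\omega$ is an extreme point of the convex set $\mathcal S^{\mathbb{P}_{\mathbb N}}(\mathfrak A)$ of $\alpha$-invariant states if and only if $\dim\mathcal H_\omega^{\mathbb{P}_{\mathbb N}}=1$.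
   Context: $\mathbb N=\{1,2,\dots\}$; $\mathbb{P}_{\mathbb N}$ is the group of permutations of $\mathbb N$ moving only finitely many points; $\mathcal P_0(\mathbb N)$ is the set of finite subsets of $\mathbb N$. A $\mathbb Z_2$-graded $C^*$-algebra is a pair $(\mathfrak A,\theta)$ with $\theta$ a $*$-automorphism, $\theta^2=\mathrm{id}$. An element $a$ is even if $\theta(a)=a$, odd if $\theta(a)=-a$, homogeneous if it is even or odd. A quasi-local algebra over $\mathcal P_0(\mathbb N)$ is a unital $\mathbb Z_2$-graded $C^*$-algebra $(\mathfrak A,\theta)$ which is the inductive limit (norm closure of the union) of a net $\{\mathfrak A(I): I\in\mathcal P_0(\mathbb N)\}$ of unital $C^*$-subalgebras of $\mathfrak A$ (local algebras) such that: (i) $I\subset J$ implies $\mathfrak A(I)\subset\mathfrak A(J)$; (ii) $\theta(\mathfrak A(I))=\mathfrak A(I)$ for all $I$; (iii) if $I\cap J=\emptyset$, $x\in\mathfrak A(I)$, $y\in\mathfrak A(J)$ are homogeneous, then $x$ and $y$ commute when at least one of them is even, and anticommute when both are odd. A local action of $\mathbb{P}_{\mathbb N}$ on $\mathfrak A$ is a group homomorphism $\alpha:\mathbb{P}_{\mathbb N}\to\mathrm{Aut}(\mathfrak A)$ such that $\alpha_\sigma\circ\theta=\theta\circ\alpha_\sigma$ for all $\sigma$, and $\alpha_\sigma(\mathfrak A(I))=\mathfrak A(\sigma(I))$ for all $\sigma$ and all finite $I\subset\mathbb N$. A state $\omega$ is $\alpha$-invariant (symmetric) if $\omega\circ\alpha_\sigma=\omega$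 for all $\sigma$. For such $\omega$ with GNS triple $(\mathcal H_\omega,\pi_\omega,\xi_\omega)$, $U^\omega_\sigma$ is the unitary on $\mathcal H_\omega$ with $U^\omega_\sigma\pi_\omega(a)\xi_\omega=\pi_\omega(\alpha_\sigma(a))\xi_\omega$; $\mathcal H_\omega^{\mathbb{P}_{\mathbb N}}=\{\xi\in\mathcal H_\omega:U^\omega_\sigma\xi=\xi\ \forall\sigma\in\mathbb{P}_{\mathbb N}\}$ and $E_\omega$ is the orthogonal projection onto it. The system is $\mathbb{P}_{\mathbb N}$-abelian if $E_\omega\pi_\omega(\mathfrak A)E_\omega$ is an abelian family of operators for every invariant state $\omega$. *)

theory Defs
  imports "HOL-Analysis.Analysis"
begin

section \<open>Complex Hilbert spaces\<close>

class complex_normed_vector = real_normed_vector +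
  fixes scaleC :: "complex \<Rightarrow> 'a \<Rightarrow> 'a"  (infixr \<open>*\<^sub>C\<close> 75)
  assumes scaleC_add_right: "c *\<^sub>C (x + y) = c *\<^sub>C x + c *\<^sub>C y"
    and scaleC_add_left: "(c + d) *\<^sub>C x = c *\<^sub>C x + d *\<^sub>C x"
    and scaleC_scaleC: "c *\<^sub>C d *\<^sub>C x = (c * d) *\<^sub>C x"
    and scaleC_one: "1 *\<^sub>C x = x"
    and scaleC_of_real: "complex_of_real r *\<^sub>C x = r *\<^sub>R x"
    and norm_scaleC: "norm (c *\<^sub>C x) = cmod c * norm x"

lemma vector_space_scaleC:
  "vector_space (scaleC :: complex \<Rightarrow> 'a::complex_normed_vector \<Rightarrow> 'a)"
  by standard (auto simp: scaleC_add_right scaleC_add_left scaleC_scaleC scaleC_one)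

text \<open>The inner product is conjugate-linear in the first argument.\<close>

class chilbert_space = complex_normed_vector + complete_space +
  fixes cinner :: "'a \<Rightarrow> 'a \<Rightarrow> complex"
  assumes cinner_commute: "cinner x y = cnj (cinner y x)"
    and cinner_add_right: "cinner x (y + z) = cinner x y + cinner x z"
    and cinner_scaleC_right: "cinner x (c *\<^sub>C y) = c * cinner x y"
    and cinner_self_nonneg: "0 \<le> Re (cinner x x)"
    and norm_eq_sqrt_cinner: "norm x = sqrt (Re (cinner x x))"

abbreviation clinear :: "('a::complex_normed_vector \<Rightarrow> 'b::complex_normed_vector) \<Rightarrow> bool"
  where "clinear \<equiv> Vector_Spaces.linear scaleC scaleC"

abbreviation cdim :: "'a::complex_normed_vector set \<Rightarrow> nat"
  where "cdim \<equiv> vector_space.dim scaleC"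

definition bounded_op :: "('h::chilbert_space \<Rightarrow> 'h) \<Rightarrow> bool"
  where "bounded_op T \<longleftrightarrow> clinear T \<and> bounded_linear T"

definition unitary_op :: "('h::chilbert_space \<Rightarrow> 'h) \<Rightarrow> bool"
  where "unitary_op U \<longleftrightarrow>
    bounded_op U \<and> surj U \<and> (\<forall>x y. cinner (U x) (U y) = cinner x y)"

definition orth_proj :: "'h::chilbert_space set \<Rightarrow> 'h \<Rightarrow> 'h"
  where "orth_proj S x = (THE y. y \<in> S \<and> (\<forall>z\<in>S. cinner z (x - y) = 0))"

definition commuting_family :: "('h \<Rightarrow> 'h) set \<Rightarrow> bool"
  where "commuting_family F \<longleftrightarrow> (\<forall>S\<in>F. \<forall>T\<in>F. S \<circ> T = T \<circ> S)"


section \<open>Unital C*-algebras\<close>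

class unital_cstar_algebra = complex_normed_vector + real_normed_algebra_1 + complete_space +
  fixes star :: "'a \<Rightarrow> 'a"
  assumes mult_scaleC_left: "(c *\<^sub>C x) * y = c *\<^sub>C (x * y)"
    and mult_scaleC_right: "x * (c *\<^sub>C y) = c *\<^sub>C (x * y)"
    and star_star: "star (star x) = x"
    and star_add: "star (x + y) = star x + star y"
    and star_scaleC: "star (c *\<^sub>C x) = cnj c *\<^sub>C star x"
    and star_mult: "star (x * y) = star y * star x"
    and cstar_identity: "norm (star x * x) = (norm x)\<^sup>2"

definition unital_cstar_subalgebra :: "'a::unital_cstar_algebra set \<Rightarrow> bool"
  where "unital_cstar_subalgebra B \<longleftrightarrow>
    1 \<in> B \<and> closed B \<and>
    (\<forall>x\<in>B. \<forall>y\<in>B. x + y \<in> B \<and> x * y \<in> B) \<and>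
    (\<forall>c. \<forall>x\<in>B. c *\<^sub>C x \<in> B) \<and>
    (\<forall>x\<in>B. star x \<in> B)"

definition star_automorphism :: "('a::unital_cstar_algebra \<Rightarrow> 'a) \<Rightarrow> bool"
  where "star_automorphism f \<longleftrightarrow>
    bij f \<and> clinear f \<and> (\<forall>x y. f (x * y) = f x * f y) \<and> (\<forall>x. f (star x) = star (f x))"


section \<open>Quasi-local algebras and local actions of finite permutations\<close>

text \<open>The index set of positive integers is represented by the type \<^typ>\<open>nat\<close>
  (relabelled to start at 0). Only the values of \<open>\<AA>\<close> on finite sets, and of \<open>\<alpha>\<close> on finite
  permutations, are meaningful.\<close>

definition finite_perms :: "(nat \<Rightarrow> nat) set"
  where "finite_perms = {\<sigma>. bij \<sigma> \<and> finite {n. \<sigma> n \<noteq> n}}"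

definition grade_even :: "('a::unital_cstar_algebra \<Rightarrow> 'a) \<Rightarrow> 'a \<Rightarrow> bool"
  where "grade_even \<theta> a \<longleftrightarrow> \<theta> a = a"

definition grade_odd :: "('a::unital_cstar_algebra \<Rightarrow> 'a) \<Rightarrow> 'a \<Rightarrow> bool"
  where "grade_odd \<theta> a \<longleftrightarrow> \<theta> a = - a"

definition homogeneous :: "('a::unital_cstar_algebra \<Rightarrow> 'a) \<Rightarrow> 'a \<Rightarrow> bool"
  where "homogeneous \<theta> a \<longleftrightarrow> grade_even \<theta> a \<or> grade_odd \<theta> a"

locale quasi_local_algebra =
  fixes \<theta> :: "'a::unital_cstar_algebra \<Rightarrow> 'a"
    and \<AA> :: "nat set \<Rightarrow> 'a set"
  assumes grading: "star_automorphism \<theta>" "\<theta> \<circ> \<theta> = id"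
    and local_subalgebra: "finite I \<Longrightarrow> unital_cstar_subalgebra (\<AA> I)"
    and inductive_limit: "closure (\<Union>I\<in>{I. finite I}. \<AA> I) = UNIV"
    and isotony: "finite I \<Longrightarrow> finite J \<Longrightarrow> I \<subseteq> J \<Longrightarrow> \<AA> I \<subseteq> \<AA> J"
    and grading_local: "finite I \<Longrightarrow> \<theta> ` \<AA> I = \<AA> I"
    and graded_locality:
      "\<lbrakk>finite I; finite J; I \<inter> J = {}; x \<in> \<AA> I; y \<in> \<AA> J; homogeneous \<theta> x; homogeneous \<theta> y\<rbrakk>
        \<Longrightarrow> (grade_even \<theta> x \<or> grade_even \<theta> y \<longrightarrow> x * y = y * x) \<and>
            (grade_odd \<theta> x \<and> grade_odd \<theta> y \<longrightarrow> x * y = - (y * x))"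

locale local_action = quasi_local_algebra \<theta> \<AA>
  for \<theta> :: "'a::unital_cstar_algebra \<Rightarrow> 'a" and \<AA> :: "nat set \<Rightarrow> 'a set" +
  fixes \<alpha> :: "(nat \<Rightarrow> nat) \<Rightarrow> 'a \<Rightarrow> 'a"
  assumes action_automorphism: "\<sigma> \<in> finite_perms \<Longrightarrow> star_automorphism (\<alpha> \<sigma>)"
    and action_comp:
      "\<sigma> \<in> finite_perms \<Longrightarrow> \<tau> \<in> finite_perms \<Longrightarrow> \<alpha> (\<sigma> \<circ> \<tau>) = \<alpha> \<sigma> \<circ> \<alpha> \<tau>"
    and action_grading: "\<sigma> \<in> finite_perms \<Longrightarrow> \<alpha> \<sigma> \<circ> \<theta> = \<theta> \<circ> \<alpha> \<sigma>"
    and action_local: "\<sigma> \<in> finite_perms \<Longrightarrow> finite I \<Longrightarrow> \<alpha> \<sigma> ` \<AA> I = \<AA> (\<sigma> ` I)"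


section \<open>States and GNS representations\<close>

text \<open>States are elements of the dual Banach space; \<^typ>\<open>'a \<Rightarrow>\<^sub>L complex\<close> only
  records real linearity, so complex linearity is required separately.\<close>

definition state :: "('a::unital_cstar_algebra \<Rightarrow>\<^sub>L complex) \<Rightarrow> bool"
  where "state \<omega> \<longleftrightarrow>
    Vector_Spaces.linear scaleC (*) (blinfun_apply \<omega>) \<and>
    (\<forall>a. blinfun_apply \<omega> (star a * a) \<in> \<real>\<^sub>\<ge>\<^sub>0) \<and> blinfun_apply \<omega> 1 = 1"

definition invariant_states ::
    "((nat \<Rightarrow> nat) \<Rightarrow> 'a \<Rightarrow> 'a) \<Rightarrow> ('a::unital_cstar_algebra \<Rightarrow>\<^sub>L complex) set"
  where "invariant_states \<alpha> =
    {\<omega>. state \<omega> \<and> (\<forall>\<sigma>\<in>finite_perms. blinfun_apply \<omega> \<circ> \<alpha> \<sigma> = blinfun_apply \<omega>)}"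

definition star_representation :: "('a::unital_cstar_algebra \<Rightarrow> 'h::chilbert_space \<Rightarrow> 'h) \<Rightarrow> bool"
  where "star_representation \<pi> \<longleftrightarrow>
    (\<forall>a. bounded_op (\<pi> a)) \<and>
    (\<forall>a b x. \<pi> (a + b) x = \<pi> a x + \<pi> b x) \<and>
    (\<forall>c a x. \<pi> (c *\<^sub>C a) x = c *\<^sub>C \<pi> a x) \<and>
    (\<forall>a b. \<pi> (a * b) = \<pi> a \<circ> \<pi> b) \<and>
    \<pi> 1 = id \<and>
    (\<forall>a x y. cinner (\<pi> (star a) x) y = cinner x (\<pi> a y))"

definition gns_triple ::
    "('a::unital_cstar_algebra \<Rightarrow>\<^sub>L complex) \<Rightarrow> ('a \<Rightarrow> 'h::chilbert_space \<Rightarrow> 'h) \<Rightarrow> 'h \<Rightarrow> bool"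
  where "gns_triple \<omega> \<pi> \<xi> \<longleftrightarrow>
    star_representation \<pi> \<and>
    closure (range (\<lambda>a. \<pi> a \<xi>)) = UNIV \<and>
    (\<forall>a. blinfun_apply \<omega> a = cinner \<xi> (\<pi> a \<xi>))"

definition gns_unitary ::
    "((nat \<Rightarrow> nat) \<Rightarrow> 'a \<Rightarrow> 'a) \<Rightarrow> ('a::unital_cstar_algebra \<Rightarrow> 'h::chilbert_space \<Rightarrow> 'h) \<Rightarrow> 'h
      \<Rightarrow> (nat \<Rightarrow> nat) \<Rightarrow> 'h \<Rightarrow> 'h"
  where "gns_unitary \<alpha> \<pi> \<xi> \<sigma> = (THE U. unitary_op U \<and> (\<forall>a. U (\<pi> a \<xi>) = \<pi> (\<alpha> \<sigma> a) \<xi>))"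

definition fixed_vectors ::
    "((nat \<Rightarrow> nat) \<Rightarrow> 'a \<Rightarrow> 'a) \<Rightarrow> ('a::unital_cstar_algebra \<Rightarrow> 'h::chilbert_space \<Rightarrow> 'h) \<Rightarrow> 'h \<Rightarrow> 'h set"
  where "fixed_vectors \<alpha> \<pi> \<xi> = {x. \<forall>\<sigma>\<in>finite_perms. gns_unitary \<alpha> \<pi> \<xi> \<sigma> x = x}"

definition fixed_proj ::
    "((nat \<Rightarrow> nat) \<Rightarrow> 'a \<Rightarrow> 'a) \<Rightarrow> ('a::unital_cstar_algebra \<Rightarrow> 'h::chilbert_space \<Rightarrow> 'h) \<Rightarrow> 'h \<Rightarrow> 'h \<Rightarrow> 'h"
  where "fixed_proj \<alpha> \<pi> \<xi> = orth_proj (fixed_vectors \<alpha> \<pi> \<xi>)"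

definition compressed_algebra ::
    "((nat \<Rightarrow> nat) \<Rightarrow> 'a \<Rightarrow> 'a) \<Rightarrow> ('a::unital_cstar_algebra \<Rightarrow> 'h::chilbert_space \<Rightarrow> 'h) \<Rightarrow> 'h
      \<Rightarrow> ('h \<Rightarrow> 'h) set"
  where "compressed_algebra \<alpha> \<pi> \<xi> =
    range (\<lambda>a. fixed_proj \<alpha> \<pi> \<xi> \<circ> \<pi> a \<circ> fixed_proj \<alpha> \<pi> \<xi>)"

text \<open>HOL cannot quantify over types inside a formula, so the type \<open>'h\<close> of the GNS spaces is a
  parameter; a system is abelian if this holds for every \<open>'h\<close>. As GNS triples are unique up to
  unitary equivalence, it does not matter that all of them are considered.\<close>

definition perm_abelian ::
    "'h::chilbert_space itself \<Rightarrow> ((nat \<Rightarrow> nat) \<Rightarrow> 'a \<Rightarrow> 'a::unital_cstar_algebra) \<Rightarrow> bool"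
  where "perm_abelian (_ :: 'h itself) \<alpha> \<longleftrightarrow>
    (\<forall>\<omega> \<in> invariant_states \<alpha>. \<forall>(\<pi> :: 'a \<Rightarrow> 'h \<Rightarrow> 'h) \<xi>.
      gns_triple \<omega> \<pi> \<xi> \<longrightarrow> commuting_family (compressed_algebra \<alpha> \<pi> \<xi>))"

end

theory Submission
  imports Defs "HOL-Computational_Algebra.Formal_Power_Series"
begin

text \<open>Any finite region can be moved off any other one by a finite permutation. Translates of an odd
  local element therefore anticommute, their averages tend to \<open>0\<close> in every symmetric state, and odd
  elements have vanishing compression to the fixed vectors; this gives evenness. For an even local
  element \<open>c\<close>, a mean ergodic argument yields convex combinations of translates \<open>c'\<close> of \<open>c\<close> with
  \<open>\<pi>(c')x\<close> close to \<open>E \<pi>(c)x\<close> for invariant \<open>x\<close>, and these can be chosen to commute with any given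
  local element: compressions commute. The same averages show that \<open>\<xi> \<plusminus> E \<pi>(h)\<xi>\<close>, for self-adjoint
  even \<open>h\<close> of norm less than \<open>1\<close>, define positive invariant functionals which decompose \<open>\<omega>\<close>, so that
  extremality forces \<open>E \<pi>(h)\<xi> = \<omega>(h)\<xi>\<close>. Conversely, an invariant state dominated by a multiple of
  \<open>\<omega>\<close> is given by a vector of the fixed space.\<close>

text \<open>For odd elements, anticommutation of \<open>star (x j)\<close> with \<open>x k\<close>
  cancels cross terms only in the sum of both products \<open>star m * m\<close> and
  \<open>m * star m\<close>. Discarding the second, nonnegative term leaves linear growth, to be
  compared with the quadratic growth of the squared value of a sum of translates. For even elements
  there is no such cancellation. Their averages need not converge in the algebra; they converge on
  invariant vectors only, and commute only with a region chosen in advance. So each argument fixes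
  the region, the vectors and the tolerance first and takes limits inside inner products. An average
  moved across an inner product turns into its adjoint, so both must converge together; this is why
  two orbits are averaged at once. Order in the algebra enters only through squares
  \<open>star b * b\<close>. The binomial series for the square root of \<open>1 - x\<close> with
  \<open>norm x < 1\<close> is the one source of squares not visible as such: it yields the
  continuity of positive functionals and of representations, and the positivity of
  \<open>1 + h\<close>.\<close>

instance chilbert_space \<subseteq> banach ..

instance unital_cstar_algebra \<subseteq> banach ..

subsection \<open>Complex Hilbert spaces\<close>

lemma scaleC_zero_left [simp]: "0 *\<^sub>C x = (0::'a::complex_normed_vector)"
  using scaleC_of_real[of 0 x] by simp

lemma scaleC_zero_right [simp]: "c *\<^sub>C 0 = (0::'a::complex_normed_vector)"
  using scaleC_add_right[of c 0 "0::'a"] by simp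

lemma scaleC_minus1 [simp]: "(-1) *\<^sub>C x = - (x::'a::complex_normed_vector)"
  using scaleC_of_real[of "-1" x] by simp

lemma clinear_iff:
  "clinear f \<longleftrightarrow> (\<forall>x y. f (x + y) = f x + f y) \<and> (\<forall>c x. f (c *\<^sub>C x) = c *\<^sub>C f x)"
  by (simp add: Vector_Spaces.linear_iff vector_space_scaleC)

lemma cfunctional_iff:
  "Vector_Spaces.linear scaleC (*) f \<longleftrightarrow>
    (\<forall>x y. f (x + y) = f x + f y) \<and> (\<forall>c x. f (c *\<^sub>C x) = c * f x)"
proof -
  have "vector_space ((*) :: complex \<Rightarrow> complex \<Rightarrow> complex)"
    by standard (auto simp: algebra_simps)
  then show ?thesis
    by (simp add: Vector_Spaces.linear_iff vector_space_scaleC)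
qed

lemma clinear_imp_linear:
  assumes "clinear f" shows "linear f"
proof (rule linearI)
  show "f (x + y) = f x + f y" for x y using assms by (simp add: clinear_iff)
  show "f (r *\<^sub>R x) = r *\<^sub>R f x" for r x
    using assms by (simp add: clinear_iff scaleC_of_real[symmetric])
qed

lemma bounded_linear_scaleC: "bounded_linear (\<lambda>x::'a::complex_normed_vector. c *\<^sub>C x)"
proof (rule bounded_linear_intro[where K = "cmod c"])
  show "c *\<^sub>C (r *\<^sub>R x) = r *\<^sub>R c *\<^sub>C x" for r and x :: 'a
    by (simp add: scaleC_scaleC mult.commute flip: scaleC_of_real)
qed (auto simp: scaleC_add_right norm_scaleC mult.commute)

lemmas continuous_on_scaleC [continuous_intros] =
  bounded_linear.continuous_on[OF bounded_linear_scaleC]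

lemma bounded_linear_scaleC_left: "bounded_linear (\<lambda>c. c *\<^sub>C (x::'a::complex_normed_vector))"
proof (rule bounded_linear_intro[where K = "norm x"])
  show "(r *\<^sub>R c) *\<^sub>C x = r *\<^sub>R c *\<^sub>C x" for r c
    by (simp add: scaleR_conv_of_real scaleC_of_real flip: scaleC_scaleC)
qed (auto simp: scaleC_add_left norm_scaleC)

lemma cinner_add_left: "cinner (x + y) z = cinner x z + cinner y (z::'a::chilbert_space)"
  by (metis cinner_commute cinner_add_right complex_cnj_add)

lemma cinner_scaleC_left: "cinner (c *\<^sub>C x) y = cnj c * cinner x (y::'a::chilbert_space)"
  by (metis cinner_commute cinner_scaleC_right complex_cnj_mult)

lemma cinner_scaleR_right: "cinner x (r *\<^sub>R y) = of_real r * cinner x (y::'a::chilbert_space)"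
  by (metis cinner_scaleC_right scaleC_of_real)

lemma cinner_scaleR_left: "cinner (r *\<^sub>R x) y = of_real r * cinner x (y::'a::chilbert_space)"
  by (metis cinner_scaleC_left scaleC_of_real complex_cnj_complex_of_real)

lemma cinner_zero_right [simp]: "cinner x 0 = (0::complex)"
  using cinner_add_right[of x 0 0] by simp

lemma cinner_zero_left [simp]: "cinner 0 x = (0::complex)"
  using cinner_add_left[of 0 0 x] by simp

lemma cinner_minus_right: "cinner x (- y) = - cinner x (y::'a::chilbert_space)"
  using cinner_add_right[of x y "- y"] by (simp add: eq_neg_iff_add_eq_0 add.commute)

lemma cinner_minus_left: "cinner (- x) y = - cinner x (y::'a::chilbert_space)"
  using cinner_add_left[of x "- x" y] by (simp add: eq_neg_iff_add_eq_0 add.commute)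

lemma cinner_diff_right: "cinner x (y - z) = cinner x y - cinner x (z::'a::chilbert_space)"
  using cinner_add_right[of x y "- z"] by (simp add: cinner_minus_right)

lemma cinner_diff_left: "cinner (x - y) z = cinner x z - cinner y (z::'a::chilbert_space)"
  using cinner_add_left[of x "- y" z] by (simp add: cinner_minus_left)

lemma cinner_self: "cinner x x = of_real ((norm (x::'a::chilbert_space))\<^sup>2)"
proof (rule complex_eqI)
  show "Re (cinner x x) = Re (of_real ((norm x)\<^sup>2))"
    using cinner_self_nonneg[of x] by (simp add: norm_eq_sqrt_cinner)
  show "Im (cinner x x) = Im (of_real ((norm x)\<^sup>2))"
    using cinner_commute[of x x] by (simp add: complex_eq_iff)
qed

lemma norm_cinner_le: "cmod (cinner x y) \<le> norm x * norm (y::'a::chilbert_space)"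
proof (cases "x = 0")
  case False
  \<comment> \<open>The coefficient of the projection of \<open>y\<close> on \<open>x\<close>; the
    squared norm of the remainder \<open>y - c *\<^sub>C x\<close> is nonnegative.\<close>
  define c where "c = cinner x y / of_real ((norm x)\<^sup>2)"
  have nx: "norm x > 0" using False by simp
  have c1: "c * of_real ((norm x)\<^sup>2) = cinner x y" using False by (simp add: c_def)
  have "cinner (y - c *\<^sub>C x) (y - c *\<^sub>C x) =
      cinner y y - c * cinner y x - cnj c * (cinner x y - c * cinner x x)"
    by (simp add: cinner_diff_left cinner_diff_right cinner_scaleC_left cinner_scaleC_right
        algebra_simps)
  also have "\<dots> = cinner y y - c * cnj (cinner x y)"
    using c1 by (simp add: cinner_self cinner_commute[of y x] del: of_real_power)
  also have "c * cnj (cinner x y) = of_real ((cmod (cinner x y))\<^sup>2 / (norm x)\<^sup>2)"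
    by (simp add: c_def complex_norm_square del: of_real_power flip: times_divide_eq_left)
  finally have "0 \<le> (norm y)\<^sup>2 - (cmod (cinner x y))\<^sup>2 / (norm x)\<^sup>2"
    using cinner_self_nonneg[of "y - c *\<^sub>C x"] by (simp add: cinner_self[of y] del: of_real_power of_real_divide)
  then have "(cmod (cinner x y))\<^sup>2 \<le> (norm x * norm y)\<^sup>2"
    using nx by (simp add: field_simps power_mult_distrib)
  then show ?thesis by (rule power2_le_imp_le) simp
qed simp

lemma bounded_linear_cinner_right: "bounded_linear (cinner (x::'a::chilbert_space))"
  by (rule bounded_linear_intro[where K = "norm x"])
    (auto simp: cinner_add_right cinner_scaleR_right scaleR_conv_of_real norm_cinner_le
      mult.commute[of _ "norm x"])

lemma bounded_linear_cinner_left: "bounded_linear (\<lambda>x. cinner x (y::'a::chilbert_space))"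
  by (rule bounded_linear_intro[where K = "norm y"])
    (auto simp: cinner_add_left cinner_scaleR_left scaleR_conv_of_real norm_cinner_le)

lemmas continuous_on_cinner_right [continuous_intros] =
  bounded_linear.continuous_on[OF bounded_linear_cinner_right]
lemmas continuous_on_cinner_left [continuous_intros] =
  bounded_linear.continuous_on[OF bounded_linear_cinner_left]

lemma cinner_eq_zero_imp: "(\<And>z. cinner z x = 0) \<Longrightarrow> x = (0::'a::chilbert_space)"
  using cinner_self[of x] by simp

lemma cinner_eq_on_dense:
  fixes x y :: "'a::chilbert_space"
  assumes "closure D = UNIV" and "\<And>z. z \<in> D \<Longrightarrow> cinner x z = cinner y z"
  shows "x = y"
proof -
  have "closure D \<subseteq> {z. cinner x z = cinner y z}"
    using assms(2) by (intro closure_minimal closed_Collect_eq continuous_intros) auto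
  then have "cinner z (x - y) = 0" for z
    using assms(1) cinner_commute[of z "x - y"] by (auto simp: cinner_diff_left)
  then show ?thesis using cinner_eq_zero_imp[of "x - y"] by simp
qed

lemma parallelogram:
  "(norm (x + y))\<^sup>2 + (norm (x - y))\<^sup>2 = 2 * (norm x)\<^sup>2 + 2 * (norm (y::'a::chilbert_space))\<^sup>2"
proof -
  have "complex_of_real ((norm (x + y))\<^sup>2 + (norm (x - y))\<^sup>2) =
      complex_of_real (2 * (norm x)\<^sup>2 + 2 * (norm y)\<^sup>2)"
    unfolding of_real_add of_real_mult cinner_self[symmetric]
    by (simp add: cinner_add_left cinner_add_right cinner_diff_left cinner_diff_right)
  then show ?thesis by (simp only: of_real_eq_iff)
qed

lemma parallelogram_Pair:
  fixes x y :: "'a::chilbert_space \<times> 'b::chilbert_space"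
  shows "(norm (x + y))\<^sup>2 + (norm (x - y))\<^sup>2 = 2 * (norm x)\<^sup>2 + 2 * (norm y)\<^sup>2"
  using parallelogram[of "fst x" "fst y"] parallelogram[of "snd x" "snd y"]
  by (simp add: norm_prod_def)

text \<open>Only the parallelogram law is assumed, so that the lemma also applies to products of
  Hilbert spaces.\<close>

lemma minimal_norm:
  fixes K :: "'v::banach set"
  assumes par: "\<And>x y::'v. (norm (x + y))\<^sup>2 + (norm (x - y))\<^sup>2 = 2 * (norm x)\<^sup>2 + 2 * (norm y)\<^sup>2"
    and K: "closed K" "convex K" "K \<noteq> {}"
  shows "\<exists>p\<in>K. (\<forall>x\<in>K. norm p \<le> norm x) \<and> (\<forall>x\<in>K. norm x = norm p \<longrightarrow> x = p)"
proof -
  define d where "d = Inf (norm ` K)"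
  have bdd: "bdd_below (norm ` K)" by (auto intro!: bdd_belowI[of _ 0])
  have d_le: "d \<le> norm x" if "x \<in> K" for x
    unfolding d_def using that bdd by (intro cInf_lower) auto
  have d0: "0 \<le> d" unfolding d_def using K(3) by (intro cInf_greatest) auto
  \<comment> \<open>The midpoint of \<open>x\<close> and \<open>y\<close> lies in \<open>K\<close>,
    so \<open>norm (x + y)\<close> is at least \<open>2 * d\<close>. The resulting bound gives both
    the Cauchy property of minimizing sequences and uniqueness.\<close>
  have diff: "(norm (x - y))\<^sup>2 \<le> 2 * ((norm x)\<^sup>2 - d\<^sup>2) + 2 * ((norm y)\<^sup>2 - d\<^sup>2)"
    if "x \<in> K" "y \<in> K" for x y
  proof -
    have "(1/2) *\<^sub>R x + (1/2) *\<^sub>R y \<in> K"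
      using K(2) that by (intro convexD) auto
    from d_le[OF this] have "2 * d \<le> norm (x + y)"
      by (simp flip: scaleR_add_right)
    then have "(2 * d)\<^sup>2 \<le> (norm (x + y))\<^sup>2"
      using d0 by (intro power_mono) auto
    then show ?thesis using par[of x y] by (simp add: power_mult_distrib)
  qed
  have "\<exists>x\<in>K. norm x < d + 1 / real (Suc n)" for n
  proof -
    have "Inf (norm ` K) < d + 1 / real (Suc n)" by (simp add: d_def)
    then show ?thesis using cInf_lessD[of "norm ` K"] K(3) by auto
  qed
  then obtain x where x: "\<And>n. x n \<in> K" "\<And>n. norm (x n) < d + 1 / real (Suc n)" by metis
  have lim: "(\<lambda>n. norm (x n)) \<longlonglongrightarrow> d"
  proof (rule tendsto_sandwich[of "\<lambda>_. d" _ _ "\<lambda>n. d + 1 / real (Suc n)"])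
    show "(\<lambda>n. d + 1 / real (Suc n)) \<longlonglongrightarrow> d"
      using tendsto_add[OF tendsto_const LIMSEQ_inverse_real_of_nat, of d]
      by (simp add: inverse_eq_divide)
  qed (use x d_le in \<open>auto intro!: always_eventually less_imp_le\<close>)
  then have lim2: "(\<lambda>n. (norm (x n))\<^sup>2) \<longlonglongrightarrow> d\<^sup>2" by (intro tendsto_intros)
  have "Cauchy x"
  proof (rule metric_CauchyI)
    fix e :: real assume e: "0 < e"
    \<comment> \<open>\<open>diff\<close> doubles each of the two excesses over
      \<open>d\<^sup>2\<close>, so a quarter of \<open>e\<^sup>2\<close> for each adds up to
      \<open>e\<^sup>2\<close>.\<close>
    have "\<forall>\<^sub>F n in sequentially. (norm (x n))\<^sup>2 < d\<^sup>2 + e\<^sup>2 / 4"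
      using lim2 e by (intro order_tendstoD) auto
    then obtain N where N: "\<And>n. n \<ge> N \<Longrightarrow> (norm (x n))\<^sup>2 < d\<^sup>2 + e\<^sup>2 / 4"
      by (auto simp: eventually_sequentially)
    have "dist (x m) (x n) < e" if "m \<ge> N" "n \<ge> N" for m n
    proof -
      have "(norm (x m - x n))\<^sup>2 < e\<^sup>2"
        using diff[OF x(1)[of m] x(1)[of n]] N[OF that(1)] N[OF that(2)] by (simp add: field_simps)
      then show ?thesis using e by (simp add: dist_norm power2_less_imp_less)
    qed
    then show "\<exists>M. \<forall>m\<ge>M. \<forall>n\<ge>M. dist (x m) (x n) < e" by blast
  qed
  then obtain p where p: "x \<longlonglongrightarrow> p" by (auto simp: Cauchy_convergent_iff convergent_def)
  have pK: "p \<in> K" using closed_sequentially[OF K(1) _ p] x(1) by auto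
  have np: "norm p = d" using LIMSEQ_unique[OF tendsto_norm[OF p] lim] .
  show ?thesis
  proof (intro bexI[OF _ pK] conjI ballI impI)
    show "norm p \<le> norm y" if "y \<in> K" for y using d_le[OF that] np by simp
    show "y = p" if "y \<in> K" "norm y = norm p" for y
      using diff[OF that(1) pK] that(2) np by simp
  qed
qed

section \<open>Closed complex subspaces and orthogonal projections\<close>

definition csubspace :: "'a::complex_normed_vector set \<Rightarrow> bool"
  where "csubspace S \<longleftrightarrow> 0 \<in> S \<and> (\<forall>x\<in>S. \<forall>y\<in>S. x + y \<in> S) \<and> (\<forall>c. \<forall>x\<in>S. c *\<^sub>C x \<in> S)"

lemma csubspace_imp_subspace: "csubspace S \<Longrightarrow> subspace S"
  by (metis csubspace_def scaleC_of_real subspace_def)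

lemma csubspace_closure:
  fixes S :: "'a::complex_normed_vector set"
  assumes S: "csubspace S" shows "csubspace (closure S)"
  unfolding csubspace_def
proof (intro conjI ballI allI)
  have sub: "S \<subseteq> closure S" by (rule closure_subset)
  show "0 \<in> closure S" using S sub by (auto simp: csubspace_def)
  \<comment> \<open>Addition is extended to the closure one argument at a time: \<open>add\<close>
    is applied first with \<open>y\<close> in \<open>S\<close>, then with \<open>y\<close> in the
    closure.\<close>
  have add: "(\<lambda>x. x + y) ` closure S \<subseteq> closure S" if "(\<lambda>x. x + y) ` S \<subseteq> closure S" for y
    using that by (intro image_closure_subset continuous_intros) auto
  have "(\<lambda>x. x + y) ` S \<subseteq> closure S" if "y \<in> S" for y
    using that S sub by (auto simp: csubspace_def)
  then have "x + y \<in> closure S" if "x \<in> closure S" "y \<in> S" for x y using add that by blast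
  then have "(\<lambda>x. x + y) ` S \<subseteq> closure S" if "y \<in> closure S" for y
    using that by (auto simp: add.commute[of _ y])
  then show "x + y \<in> closure S" if "x \<in> closure S" "y \<in> closure S" for x y using add that by blast
  have "(\<lambda>x. c *\<^sub>C x) ` closure S \<subseteq> closure S" for c
    using S sub
    by (intro image_closure_subset linear_continuous_on[OF bounded_linear_scaleC])
      (auto simp: csubspace_def)
  then show "c *\<^sub>C x \<in> closure S" if "x \<in> closure S" for c x using that by blast
qed

lemma projection_exists:
  fixes S :: "'h::chilbert_space set"
  assumes "closed S" "csubspace S"
  shows "\<exists>y\<in>S. \<forall>z\<in>S. cinner z (x - y) = 0"
proof -
  have sub: "subspace S" using assms(2) by (rule csubspace_imp_subspace)
  \<comment> \<open>As \<open>S\<close> is closed under negation, \<open>K\<close> consists of all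
    differences \<open>x - y\<close> with \<open>y\<close> in \<open>S\<close>; its point of minimal
    norm comes from the nearest point of \<open>S\<close>.\<close>
  define K where "K = (+) x ` S"
  have "closed K" "convex K" "K \<noteq> {}"
    using assms(1) subspace_imp_convex[OF sub] subspace_0[OF sub]
    by (auto simp: K_def closed_translation)
  from minimal_norm[OF parallelogram this]
  obtain p where p: "p \<in> K" "\<And>q. q \<in> K \<Longrightarrow> norm p \<le> norm q" by auto
  then obtain y' where y': "y' \<in> S" "p = x + y'" by (auto simp: K_def)
  define y where "y = - y'"
  have y: "y \<in> S" "p = x - y" using y' subspace_neg[OF sub] by (auto simp: y_def)
  have "cinner z p = 0" if z: "z \<in> S" for z
  proof (cases "z = 0")
    case False
    \<comment> \<open>Removing from \<open>p\<close> its component along \<open>z\<close> stays in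
      \<open>K\<close> and lowers the squared norm by the quotient computed below; minimality of
      \<open>p\<close> forces that quotient to vanish.\<close>
    define c where "c = cinner z p / of_real ((norm z)\<^sup>2)"
    have c1: "c * of_real ((norm z)\<^sup>2) = cinner z p" using False by (simp add: c_def)
    have "p - c *\<^sub>C z = x + (y' - c *\<^sub>C z)" by (simp add: y'(2))
    moreover have "y' - c *\<^sub>C z \<in> S"
      using assms(2) y'(1) z by (intro subspace_diff[OF sub]) (auto simp: csubspace_def)
    ultimately have "p - c *\<^sub>C z \<in> K" unfolding K_def by blast
    then have le: "(norm p)\<^sup>2 \<le> (norm (p - c *\<^sub>C z))\<^sup>2" using p(2) by (intro power_mono) auto
    have "complex_of_real ((norm (p - c *\<^sub>C z))\<^sup>2) =
        cinner p p - c * cinner p z - cnj c * (cinner z p - c * cinner z z)"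
      unfolding cinner_self[symmetric]
      by (simp add: cinner_diff_left cinner_diff_right cinner_scaleC_left cinner_scaleC_right
        algebra_simps)
    also have "\<dots> = cinner p p - c * cnj (cinner z p)"
      using c1 by (simp add: cinner_self cinner_commute[of p z] del: of_real_power)
    also have "c * cnj (cinner z p) = of_real ((cmod (cinner z p))\<^sup>2 / (norm z)\<^sup>2)"
      by (simp add: c_def complex_norm_square del: of_real_power flip: times_divide_eq_left)
    finally have "complex_of_real ((norm (p - c *\<^sub>C z))\<^sup>2) =
        of_real ((norm p)\<^sup>2 - (cmod (cinner z p))\<^sup>2 / (norm z)\<^sup>2)"
      by (simp add: cinner_self)
    then have "(norm (p - c *\<^sub>C z))\<^sup>2 = (norm p)\<^sup>2 - (cmod (cinner z p))\<^sup>2 / (norm z)\<^sup>2"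
      by (simp only: of_real_eq_iff)
    with le have "(cmod (cinner z p))\<^sup>2 / (norm z)\<^sup>2 \<le> 0" by linarith
    then show ?thesis using False by (simp add: divide_le_0_iff)
  qed simp
  then show ?thesis using y by auto
qed

lemma orth_proj_eqI:
  fixes S :: "'h::chilbert_space set"
  assumes "csubspace S" "y \<in> S" "\<And>z. z \<in> S \<Longrightarrow> cinner z (x - y) = 0"
  shows "orth_proj S x = y"
  unfolding orth_proj_def
proof (rule the_equality)
  fix y' assume y': "y' \<in> S \<and> (\<forall>z\<in>S. cinner z (x - y') = 0)"
  have "y' - y \<in> S"
    using csubspace_imp_subspace[OF assms(1)] y' assms(2) by (simp add: subspace_diff)
  then have "cinner (y' - y) (x - y) = 0" "cinner (y' - y) (x - y') = 0"
    using assms(3) y' by auto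
  then have "cinner (y' - y) (y' - y) = 0" by (simp add: cinner_diff_right)
  then show "y' = y" by (simp add: cinner_self)
qed (use assms in auto)

lemma
  fixes S :: "'h::chilbert_space set"
  assumes "closed S" "csubspace S"
  shows orth_proj_mem: "orth_proj S x \<in> S"
    and orth_proj_orthogonal: "z \<in> S \<Longrightarrow> cinner z (x - orth_proj S x) = 0"
  using projection_exists[OF assms, of x] orth_proj_eqI[OF assms(2)] by metis+

subsection \<open>Positive functionals on unital C*-algebras\<close>

lemma star_zero [simp]: "star (0::'a::unital_cstar_algebra) = 0"
  using star_add[of 0 "0::'a"] by simp

lemma star_minus: "star (- x) = - star (x::'a::unital_cstar_algebra)"
  using star_add[of x "- x"] by (simp add: eq_neg_iff_add_eq_0 add.commute)

lemma star_diff: "star (x - y) = star x - star (y::'a::unital_cstar_algebra)"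
  using star_add[of x "- y"] by (simp add: star_minus)

lemma star_one [simp]: "star (1::'a::unital_cstar_algebra) = 1"
  by (metis mult_1 mult.right_neutral star_mult star_star)

lemma star_scaleR: "star (r *\<^sub>R x) = r *\<^sub>R star (x::'a::unital_cstar_algebra)"
  by (metis complex_cnj_complex_of_real scaleC_of_real star_scaleC)

lemma star_power: "star (x ^ n) = star (x::'a::unital_cstar_algebra) ^ n"
  by (induction n) (auto simp: star_mult power_commutes)

lemma norm_star [simp]: "norm (star x) = norm (x::'a::unital_cstar_algebra)"
proof -
  have "norm y \<le> norm (star y)" for y :: 'a
  proof (cases "y = 0")
    case False
    have "norm y * norm y \<le> norm (star y) * norm y"
      using cstar_identity[of y] norm_mult_ineq[of "star y" y] by (simp add: power2_eq_square)
    then show ?thesis using False by simp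
  qed simp
  from this[of x] this[of "star x"] show ?thesis by (simp add: star_star)
qed

lemma bounded_linear_star: "bounded_linear (star :: 'a::unital_cstar_algebra \<Rightarrow> 'a)"
  by (rule bounded_linear_intro[where K = 1]) (auto simp: star_add star_scaleR)

text \<open>Dominates the binomial series of the square root by a geometric series. Consecutive
  coefficients have ratio \<open>(1/2 - n) / (n + 1)\<close>, of modulus at most 1.\<close>

lemma abs_half_gchoose_le: "\<bar>(1/2::real) gchoose n\<bar> \<le> 1"
proof (induction n)
  case (Suc n)
  have "(1/2::real) gchoose Suc n = ((1/2) gchoose n) * ((1/2 - real n) / real (Suc n))"
    by (simp add: gbinomial_prod_rev field_simps)
  moreover have "\<bar>(1/2 - real n) / real (Suc n)\<bar> \<le> 1" by (simp add: divide_le_eq)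
  ultimately show ?case using Suc.IH by (simp only: abs_mult) (intro mult_le_one; simp)
qed simp

text \<open>The root is the binomial series with exponent 1/2, absolutely convergent for
  \<open>norm x < 1\<close>. Its terms are self-adjoint, and by the Cauchy product and Vandermonde's
  identity its square is the binomial series with exponent 1.\<close>

lemma sqrt_one_minus:
  fixes x :: "'a::unital_cstar_algebra"
  assumes "norm x < 1" "star x = x"
  obtains b where "star b * b = 1 - x"
proof -
  define f where "f n = ((1/2::real) gchoose n) *\<^sub>R (- x) ^ n" for n
  have nf: "norm (f n) \<le> norm x ^ n" for n
  proof -
    have "norm (f n) = \<bar>(1/2::real) gchoose n\<bar> * norm ((- x) ^ n)" by (simp add: f_def)
    also have "\<dots> \<le> 1 * norm (- x) ^ n"
      by (intro mult_mono abs_half_gchoose_le norm_power_ineq) auto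
    finally show ?thesis by simp
  qed
  have sn: "summable (\<lambda>n. norm (f n))"
    by (rule summable_comparison_test[of _ "\<lambda>n. norm x ^ n"])
      (use nf assms in \<open>auto intro!: exI[of _ 0] simp: summable_geometric\<close>)
  define b where "b = (\<Sum>n. f n)"
  have sums: "f sums b" unfolding b_def by (intro summable_sums summable_norm_cancel[OF sn])
  have "(\<lambda>n. star (f n)) sums star b"
    by (rule bounded_linear.sums[OF bounded_linear_star sums])
  moreover have "star (f n) = f n" for n
    by (simp add: f_def star_scaleR star_power star_minus assms(2))
  ultimately have sb: "star b = b" using sums sums_unique2 by auto
  have "(\<Sum>i\<le>n. f i * f (n - i)) = (1 gchoose n) *\<^sub>R (- x) ^ n" for n
  proof -
    have "(\<Sum>i\<le>n. f i * f (n - i)) =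
        (\<Sum>i\<le>n. (((1/2) gchoose i) * ((1/2) gchoose (n - i))) *\<^sub>R (- x) ^ n)"
      by (rule sum.cong) (auto simp: f_def simp flip: power_add)
    also have "\<dots> = ((1/2 + 1/2) gchoose n) *\<^sub>R (- x) ^ n"
      by (simp only: scaleR_sum_left[symmetric] atLeast0AtMost[symmetric] gbinomial_Vandermonde)
    finally show ?thesis by simp
  qed
  then have "(\<lambda>n. (1 gchoose n) *\<^sub>R (- x) ^ n) sums (b * b)"
    using Cauchy_product_sums[OF sn sn] by (simp add: b_def)
  \<comment> \<open>With exponent 1 the series stops after the terms 0 and 1, which leaves
    \<open>1 - x\<close>.\<close>
  moreover have "(\<lambda>n. ((1::real) gchoose n) *\<^sub>R (- x) ^ n) sums (\<Sum>n\<in>{0,1}. (1 gchoose n) *\<^sub>R (- x) ^ n)"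
  proof (rule sums_finite)
    fix n :: nat assume "n \<notin> {0, 1}"
    then have "(1::nat) < n" by auto
    then show "((1::real) gchoose n) *\<^sub>R (- x) ^ n = 0"
      using binomial_gbinomial[of 1 n, where 'a = real] by (simp add: binomial_eq_0)
  qed auto
  ultimately have "b * b = 1 - x" using sums_unique2 by fastforce
  then show ?thesis using that sb by metis
qed

definition positive_functional :: "('a::unital_cstar_algebra \<Rightarrow> complex) \<Rightarrow> bool"
  where "positive_functional \<phi> \<longleftrightarrow> (\<forall>a b. \<phi> (a + b) = \<phi> a + \<phi> b) \<and>
    (\<forall>c a. \<phi> (c *\<^sub>C a) = c * \<phi> a) \<and> (\<forall>a. \<phi> (star a * a) \<in> \<real>\<^sub>\<ge>\<^sub>0)"

context
  fixes \<phi> :: "'a::unital_cstar_algebra \<Rightarrow> complex"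
  assumes pos: "positive_functional \<phi>"
begin

lemma positive_functional_add: "\<phi> (a + b) = \<phi> a + \<phi> b"
  using pos by (simp add: positive_functional_def)

lemma positive_functional_scaleC: "\<phi> (c *\<^sub>C a) = c * \<phi> a"
  using pos by (simp add: positive_functional_def)

lemma positive_functional_scaleR: "\<phi> (r *\<^sub>R a) = of_real r * \<phi> a"
  by (metis positive_functional_scaleC scaleC_of_real)

lemma positive_functional_minus: "\<phi> (- a) = - \<phi> a"
  using positive_functional_scaleC[of "-1" a] by simp

lemma positive_functional_diff: "\<phi> (a - b) = \<phi> a - \<phi> b"
  using positive_functional_add[of a "- b"] by (simp add: positive_functional_minus)

lemma positive_functional_zero: "\<phi> 0 = 0"
  using positive_functional_diff[of 0 0] by simp

lemma positive_functional_sum: "\<phi> (\<Sum>i\<in>I. f i) = (\<Sum>i\<in>I. \<phi> (f i))"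
  by (induction I rule: infinite_finite_induct)
    (auto simp: positive_functional_zero positive_functional_add)

lemma positive_functional_square: "\<phi> (star a * a) = of_real (Re (\<phi> (star a * a)))"
    "0 \<le> Re (\<phi> (star a * a))"
  using pos by (auto simp: positive_functional_def complex_nonneg_Reals_iff complex_eq_iff)

text \<open>Polarisation against the unit: the squares of \<open>a + c *\<^sub>C 1\<close> have real
  values, and \<open>c = 1\<close> and \<open>c = \<i>\<close> compare the imaginary and the real
  parts respectively.\<close>

lemma positive_functional_star: "\<phi> (star a) = cnj (\<phi> a)"
proof -
  have "\<phi> (star (a + c *\<^sub>C 1) * (a + c *\<^sub>C 1)) =
      \<phi> (star a * a) + c * \<phi> (star a) + cnj c * \<phi> a + cnj c * c * \<phi> 1" for c
    by (simp add: star_add star_scaleC distrib_left distrib_right positive_functional_add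
        mult_scaleC_left mult_scaleC_right positive_functional_scaleC)
  then have eq: "c * \<phi> (star a) + cnj c * \<phi> a =
      \<phi> (star (a + c *\<^sub>C 1) * (a + c *\<^sub>C 1)) - \<phi> (star a * a) - cnj c * c * \<phi> (star 1 * 1)" for c
    by simp
  have "Im (c * \<phi> (star a) + cnj c * \<phi> a) = 0" for c
  proof -
    have "Im (\<phi> (star b * b)) = 0" for b
      using pos by (simp add: positive_functional_def complex_nonneg_Reals_iff)
    from this[of 1] this show ?thesis unfolding eq by simp
  qed
  from this[of 1] this[of \<i>] show ?thesis by (simp add: complex_eq_iff)
qed

text \<open>For \<open>t\<close> strictly above \<open>(norm a)\<^sup>2\<close> the element
  \<open>1 - (1/t) *\<^sub>R (star a * a)\<close> is a square by \<open>sqrt_one_minus\<close>, so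
  \<phi> is nonnegative on it. The strict inequality is removed by letting \<open>t\<close>
  decrease.\<close>

lemma positive_functional_norm_le: "Re (\<phi> (star a * a)) \<le> (norm a)\<^sup>2 * Re (\<phi> 1)"
proof -
  have *: "Re (\<phi> (star a * a)) \<le> t * Re (\<phi> 1)" if t: "t > (norm a)\<^sup>2" for t
  proof -
    have t0: "t > 0" using t by (smt (verit) zero_le_power2)
    have "norm ((1/t) *\<^sub>R (star a * a)) < 1"
      using t t0 by (simp add: cstar_identity)
    moreover have "star ((1/t) *\<^sub>R (star a * a)) = (1/t) *\<^sub>R (star a * a)"
      by (simp add: star_scaleR star_mult star_star)
    ultimately obtain b where "star b * b = 1 - (1/t) *\<^sub>R (star a * a)"
      by (rule sqrt_one_minus)
    then have "0 \<le> Re (\<phi> (1 - (1/t) *\<^sub>R (star a * a)))"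
      using positive_functional_square(2)[of b] by simp
    then show ?thesis
      using t0 by (simp add: positive_functional_diff positive_functional_scaleR field_simps)
  qed
  have "((\<lambda>t. t * Re (\<phi> 1)) \<longlongrightarrow> (norm a)\<^sup>2 * Re (\<phi> 1)) (at_right ((norm a)\<^sup>2))"
    by (intro tendsto_intros)
  then show ?thesis
    by (rule tendsto_lowerbound) (use * in \<open>auto simp: eventually_at_right_less eventually_at_filter\<close>)
qed

text \<open>This is Cauchy-Schwarz against the unit; it follows from positivity at
  \<open>a - \<phi> a *\<^sub>C 1\<close>, which minimises the quadratic expression.\<close>

lemma positive_functional_Schwarz:
  assumes "\<phi> 1 = 1"
  shows "(cmod (\<phi> a))\<^sup>2 \<le> Re (\<phi> (star a * a))"
proof -
  define c where "c = \<phi> a"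
  have "\<phi> (star (a - c *\<^sub>C 1) * (a - c *\<^sub>C 1)) = \<phi> (star a * a) - c * cnj c"
    by (simp add: star_diff star_scaleC left_diff_distrib right_diff_distrib positive_functional_diff
        mult_scaleC_left mult_scaleC_right positive_functional_scaleC positive_functional_star
        assms c_def[symmetric])
  then have "0 \<le> Re (\<phi> (star a * a) - c * cnj c)"
    using positive_functional_square(2)[of "a - c *\<^sub>C 1"] by simp
  then show ?thesis by (simp add: c_def complex_mult_cnj cmod_power2)
qed

lemma positive_functional_contractive:
  assumes "\<phi> 1 = 1"
  shows "cmod (\<phi> a) \<le> norm a"
proof -
  have "(cmod (\<phi> a))\<^sup>2 \<le> (norm a)\<^sup>2"
    using order_trans[OF positive_functional_Schwarz[OF assms] positive_functional_norm_le] assms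
    by simp
  then show ?thesis by (rule power2_le_imp_le) simp
qed

end

lemma state_positive: "state \<omega> \<Longrightarrow> positive_functional (blinfun_apply \<omega>)"
  by (auto simp: state_def positive_functional_def cfunctional_iff)

lemma star_automorphism_one:
  assumes "star_automorphism f"
  shows "f 1 = 1"
proof -
  obtain a where "f a = 1" using assms by (metis bij_pointE star_automorphism_def)
  moreover have "f (a * 1) = f a * f 1" using assms by (simp only: star_automorphism_def)
  ultimately show ?thesis by simp
qed

text \<open>The form in which sums of odd translates are exploited: \<open>r\<close> is the common
  modulus on the single translates, and \<open>K\<close> bounds the linear growth given by
  \<open>odd_average\<close>. Dividing by the square of \<open>Suc n\<close> leaves a bound tending
  to 0.\<close>

lemma zero_of_square_growth:
  fixes r K :: real
  assumes "\<And>n. (real (Suc n) * r)\<^sup>2 \<le> real (Suc n) * K"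
  shows "r = 0"
proof -
  have "r\<^sup>2 \<le> K / real (Suc n)" for n
  proof -
    have "real (Suc n) * (real (Suc n) * r\<^sup>2) \<le> real (Suc n) * K"
      using assms[of n] by (simp only: power_mult_distrib power2_eq_square[of "real (Suc n)"] mult.assoc)
    then have "real (Suc n) * r\<^sup>2 \<le> K"
      by (simp only: mult_le_cancel_left_pos of_nat_0_less_iff zero_less_Suc)
    then show ?thesis by (simp only: pos_le_divide_eq of_nat_0_less_iff zero_less_Suc mult.commute)
  qed
  moreover have "(\<lambda>n. K / real (Suc n)) \<longlonglongrightarrow> 0"
    using tendsto_mult[OF tendsto_const LIMSEQ_inverse_real_of_nat, of K]
    by (simp add: divide_inverse)
  ultimately have "r\<^sup>2 \<le> 0"
    by (intro LIMSEQ_le_const) auto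
  then show ?thesis by simp
qed

subsection \<open>Finite permutations\<close>

text \<open>For \<open>N \<le> q\<close> this is the involution that exchanges the intervals
  \<open>{..<N}\<close> and \<open>{q..<q + N}\<close> by translation.\<close>

definition block_swap :: "nat \<Rightarrow> nat \<Rightarrow> nat \<Rightarrow> nat"
  where "block_swap N q m =
    (if m < N then m + q else if q \<le> m \<and> m < q + N then m - q else m)"

lemma block_swap_finite_perms:
  assumes "N \<le> q" shows "block_swap N q \<in> finite_perms"
proof -
  have "block_swap N q (block_swap N q m) = m" for m
    using assms by (auto simp: block_swap_def)
  then have "bij (block_swap N q)" by (intro involuntory_imp_bij)
  moreover have "{m. block_swap N q m \<noteq> m} \<subseteq> {..<q + N}"
    using assms by (auto simp: block_swap_def split: if_splits)
  ultimately show ?thesis by (simp add: finite_perms_def finite_subset)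
qed

lemma block_swap_image: "I \<subseteq> {..<N} \<Longrightarrow> block_swap N q ` I \<subseteq> {q..<q + N}"
  by (auto simp: block_swap_def)

lemma separating_perm:
  assumes "finite I" "finite J"
  obtains \<sigma> where "\<sigma> \<in> finite_perms" "\<sigma> ` I \<inter> J = {}"
proof -
  obtain N where N: "I \<union> J \<subseteq> {..<N}" using assms finite_nat_iff_bounded[of "I \<union> J"] by auto
  have "block_swap N N ` I \<inter> J = {}"
  proof -
    have "block_swap N N ` I \<subseteq> {N..<N + N}" "J \<subseteq> {..<N}"
      using N block_swap_image[of I N N] by auto
    moreover have "{N..<N + N} \<inter> {..<N} = {}" by auto
    ultimately show ?thesis by blast
  qed
  with block_swap_finite_perms[of N N] show ?thesis by (intro that) auto
qed

lemma separating_perms: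
  assumes "finite I"
  obtains \<sigma> :: "nat \<Rightarrow> nat \<Rightarrow> nat" where "\<And>k. \<sigma> k \<in> finite_perms"
    "\<And>k l. k \<noteq> l \<Longrightarrow> \<sigma> k ` I \<inter> \<sigma> l ` I = {}"
proof -
  obtain N where N: "I \<subseteq> {..<N}" using assms finite_nat_iff_bounded by auto
  \<comment> \<open>Block \<open>k\<close> starts at \<open>Suc k * N\<close>: consecutive blocks
    are adjacent, and the offset by one keeps all of them off \<open>{..<N}\<close>, as
    \<open>block_swap_finite_perms\<close> requires.\<close>
  define \<sigma> where "\<sigma> k = block_swap N (Suc k * N)" for k
  have disj: "\<sigma> k ` I \<inter> \<sigma> l ` I = {}" if "k < l" for k l
  proof -
    have "Suc k * N + N \<le> Suc l * N" using that mult_le_mono1[of "Suc (Suc k)" "Suc l" N] by simp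
    then have "{Suc k * N..<Suc k * N + N} \<inter> {Suc l * N..<Suc l * N + N} = {}" by auto
    then show ?thesis
      using block_swap_image[OF N, of "Suc k * N"] block_swap_image[OF N, of "Suc l * N"]
      unfolding \<sigma>_def by blast
  qed
  show ?thesis
  proof
    show "\<sigma> k \<in> finite_perms" for k by (simp add: \<sigma>_def block_swap_finite_perms)
    show "\<sigma> k ` I \<inter> \<sigma> l ` I = {}" if "k \<noteq> l" for k l
      using disj[of k l] disj[of l k] that by (cases "k < l") (auto simp: Int_commute)
  qed
qed

lemma id_finite_perms: "id \<in> finite_perms"
  by (simp add: finite_perms_def)

lemma comp_finite_perms:
  assumes "\<sigma> \<in> finite_perms" "\<tau> \<in> finite_perms" shows "\<sigma> \<circ> \<tau> \<in> finite_perms"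
proof -
  have "{n. (\<sigma> \<circ> \<tau>) n \<noteq> n} \<subseteq> {n. \<sigma> n \<noteq> n} \<union> {n. \<tau> n \<noteq> n}" by auto
  with assms show ?thesis
    by (auto simp: finite_perms_def intro: bij_comp finite_subset)
qed

lemma inv_finite_perms:
  assumes "\<sigma> \<in> finite_perms" shows "inv \<sigma> \<in> finite_perms"
proof -
  have bij: "bij \<sigma>" using assms by (simp add: finite_perms_def)
  then have "{n. inv \<sigma> n \<noteq> n} = {n. \<sigma> n \<noteq> n}"
    by (metis bij_inv_eq_iff)
  with assms show ?thesis by (simp add: finite_perms_def bij_imp_bij_inv)
qed

subsection \<open>Local actions\<close>

context quasi_local_algebra
begin

lemma theta_add: "\<theta> (a + b) = \<theta> a + \<theta> b"
  and theta_scaleC: "\<theta> (c *\<^sub>C a) = c *\<^sub>C \<theta> a"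
  and theta_mult: "\<theta> (a * b) = \<theta> a * \<theta> b"
  and theta_star: "\<theta> (star a) = star (\<theta> a)"
  and theta_theta: "\<theta> (\<theta> a) = a"
  using grading by (auto simp: star_automorphism_def clinear_iff fun_eq_iff)

lemma theta_minus: "\<theta> (- a) = - \<theta> a"
  using theta_scaleC[of "-1" a] by simp

lemma theta_diff: "\<theta> (a - b) = \<theta> a - \<theta> b"
  using theta_add[of a "- b"] by (simp add: theta_minus)

lemma theta_scaleR: "\<theta> (r *\<^sub>R a) = r *\<^sub>R \<theta> a"
  using theta_scaleC[of "of_real r" a] by (simp add: scaleC_of_real)

context
  fixes I :: "nat set"
  assumes I: "finite I"
begin

lemma local_add: "x \<in> \<AA> I \<Longrightarrow> y \<in> \<AA> I \<Longrightarrow> x + y \<in> \<AA> I"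
  and local_scaleC: "x \<in> \<AA> I \<Longrightarrow> c *\<^sub>C x \<in> \<AA> I"
  and local_star: "x \<in> \<AA> I \<Longrightarrow> star x \<in> \<AA> I"
  and local_theta: "x \<in> \<AA> I \<Longrightarrow> \<theta> x \<in> \<AA> I"
  using local_subalgebra[OF I] grading_local[OF I] by (auto simp: unital_cstar_subalgebra_def)

lemma local_scaleR: "x \<in> \<AA> I \<Longrightarrow> r *\<^sub>R x \<in> \<AA> I"
  using local_scaleC[of x "of_real r"] by (simp add: scaleC_of_real)

lemma local_diff: "x \<in> \<AA> I \<Longrightarrow> y \<in> \<AA> I \<Longrightarrow> x - y \<in> \<AA> I"
  using local_add[of x "(-1) *\<^sub>C y"] local_scaleC[of y "-1"] by simp

end

definition local_algebra :: "'a set"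
  where "local_algebra = (\<Union>I\<in>{I. finite I}. \<AA> I)"

lemma local_algebraI: "finite I \<Longrightarrow> a \<in> \<AA> I \<Longrightarrow> a \<in> local_algebra"
  by (auto simp: local_algebra_def)

lemma closure_local_algebra: "closure local_algebra = UNIV"
  using inductive_limit by (simp add: local_algebra_def)

definition even_local :: "'a set"
  where "even_local = {a \<in> local_algebra. \<theta> a = a}"

text \<open>Graded locality speaks of homogeneous elements only; this is the reduction of other
  local elements to them. Both parts stay in the same local algebra because \<theta> preserves
  it.\<close>

lemma parity_decomposition:
  assumes "finite I" "a \<in> \<AA> I"
  obtains b c where "a = b + c" "b \<in> \<AA> I" "\<theta> b = b" "c \<in> \<AA> I" "\<theta> c = - c"
proof
  show "a = (1/2) *\<^sub>R (a + \<theta> a) + (1/2) *\<^sub>R (a - \<theta> a)"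
    by (simp flip: scaleR_add_right)
  show "(1/2) *\<^sub>R (a + \<theta> a) \<in> \<AA> I" "(1/2) *\<^sub>R (a - \<theta> a) \<in> \<AA> I"
    using assms by (intro local_scaleR local_add local_diff local_theta; simp)+
  show "\<theta> ((1/2) *\<^sub>R (a + \<theta> a)) = (1/2) *\<^sub>R (a + \<theta> a)"
    by (simp add: theta_scaleR theta_add theta_theta add.commute)
  show "\<theta> ((1/2) *\<^sub>R (a - \<theta> a)) = - ((1/2) *\<^sub>R (a - \<theta> a))"
    by (simp add: theta_scaleR theta_diff theta_theta scaleR_diff_right)
qed

lemma odd_anticommute:
  assumes "finite I" "finite J" "I \<inter> J = {}" "x \<in> \<AA> I" "y \<in> \<AA> J" "\<theta> x = - x" "\<theta> y = - y"
  shows "x * y = - (y * x)"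
  using graded_locality[OF assms(1-5)] assms(6,7) by (auto simp: homogeneous_def grade_odd_def)

lemma even_commute:
  assumes "finite I" "finite J" "I \<inter> J = {}" "x \<in> \<AA> I" "y \<in> \<AA> J" "\<theta> x = x"
  shows "x * y = y * x"
proof -
  obtain b c where bc: "y = b + c" "b \<in> \<AA> J" "\<theta> b = b" "c \<in> \<AA> J" "\<theta> c = - c"
    using parity_decomposition assms by metis
  have "x * b = b * x" "x * c = c * x"
    using graded_locality[OF assms(1-4) bc(2)] graded_locality[OF assms(1-4) bc(4)] assms(6) bc(3,5)
    by (auto simp: homogeneous_def grade_odd_def grade_even_def)
  then show ?thesis by (simp add: bc(1) distrib_left distrib_right)
qed

text \<open>Real subspaces are convex, so convex combinations of translates remain even and local.
  Two summands meet in the algebra of the union of their regions.\<close>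

lemma subspace_even_local: "subspace even_local"
proof (rule subspaceI)
  have "0 \<in> \<AA> {}" using local_scaleC[of "{}" 1 0] local_subalgebra[of "{}"]
    by (simp add: unital_cstar_subalgebra_def)
  then show "0 \<in> even_local"
    using theta_scaleC[of 0 0] by (auto simp: even_local_def intro: local_algebraI)
  fix x y :: 'a
  assume x: "x \<in> even_local"
  then obtain I where I: "finite I" "x \<in> \<AA> I" "\<theta> x = x"
    by (auto simp: even_local_def local_algebra_def)
  show "r *\<^sub>R x \<in> even_local" for r
    using I local_scaleR by (auto simp: even_local_def theta_scaleR intro: local_algebraI)
  assume "y \<in> even_local"
  then obtain J where J: "finite J" "y \<in> \<AA> J" "\<theta> y = y"
    by (auto simp: even_local_def local_algebra_def)
  have "x \<in> \<AA> (I \<union> J)" "y \<in> \<AA> (I \<union> J)"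
    using isotony[of I "I \<union> J"] isotony[of J "I \<union> J"] I J by auto
  then have "x + y \<in> local_algebra"
    using I J by (intro local_algebraI[of "I \<union> J"] local_add) auto
  then show "x + y \<in> even_local" using I J by (simp add: even_local_def theta_add)
qed

lemma one_even_local: "1 \<in> even_local"
proof -
  have "1 \<in> \<AA> {}" using local_subalgebra[of "{}"] by (simp add: unital_cstar_subalgebra_def)
  then show ?thesis
    using star_automorphism_one[OF grading(1)] local_algebraI[of "{}" 1] by (simp add: even_local_def)
qed

lemma even_local_star: "a \<in> even_local \<Longrightarrow> star a \<in> even_local"
  unfolding even_local_def local_algebra_def using local_star theta_star by force

lemma even_local_scaleC: "a \<in> even_local \<Longrightarrow> c *\<^sub>C a \<in> even_local"
  unfolding even_local_def local_algebra_def using local_scaleC theta_scaleC by force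

end

context local_action
begin

lemma alpha_linear: "\<sigma> \<in> finite_perms \<Longrightarrow> linear (\<alpha> \<sigma>)"
  using action_automorphism by (simp add: star_automorphism_def clinear_imp_linear)

context
  fixes \<sigma> assumes \<sigma>: "\<sigma> \<in> finite_perms"
begin

lemma alpha_add: "\<alpha> \<sigma> (a + b) = \<alpha> \<sigma> a + \<alpha> \<sigma> b"
  and alpha_mult: "\<alpha> \<sigma> (a * b) = \<alpha> \<sigma> a * \<alpha> \<sigma> b"
  and alpha_star: "\<alpha> \<sigma> (star a) = star (\<alpha> \<sigma> a)"
  and alpha_theta: "\<theta> (\<alpha> \<sigma> a) = \<alpha> \<sigma> (\<theta> a)"
  and alpha_one: "\<alpha> \<sigma> 1 = 1"
  using action_automorphism[OF \<sigma>] action_grading[OF \<sigma>]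
    star_automorphism_one[OF action_automorphism[OF \<sigma>]]
  by (auto simp: star_automorphism_def clinear_iff fun_eq_iff)

lemma alpha_minus: "\<alpha> \<sigma> (- a) = - \<alpha> \<sigma> a"
  by (rule linear_neg[OF alpha_linear[OF \<sigma>]])

lemma alpha_diff: "\<alpha> \<sigma> (a - b) = \<alpha> \<sigma> a - \<alpha> \<sigma> b"
  by (rule linear_diff[OF alpha_linear[OF \<sigma>]])

lemma alpha_local: "finite I \<Longrightarrow> a \<in> \<AA> I \<Longrightarrow> \<alpha> \<sigma> a \<in> \<AA> (\<sigma> ` I)"
  using action_local[OF \<sigma>] by blast

lemma alpha_even_local:
  assumes "a \<in> even_local" shows "\<alpha> \<sigma> a \<in> even_local"
proof -
  obtain I where "finite I" "a \<in> \<AA> I" "\<theta> a = a"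
    using assms by (auto simp: even_local_def local_algebra_def)
  then show ?thesis
    using local_algebraI[of "\<sigma> ` I"] by (simp add: even_local_def alpha_theta alpha_local)
qed

end

text \<open>Multiplicativity makes \<open>\<alpha> id\<close> idempotent, and an injective
  idempotent map is the identity.\<close>

lemma alpha_id: "\<alpha> id = id"
proof
  fix a
  have "\<alpha> id (\<alpha> id a) = \<alpha> id a"
    using action_comp[OF id_finite_perms id_finite_perms] by (simp add: fun_eq_iff)
  moreover have "inj (\<alpha> id)"
    using action_automorphism[OF id_finite_perms] by (simp add: star_automorphism_def bij_is_inj)
  ultimately show "\<alpha> id a = id a" by (simp add: inj_eq)
qed

lemma alpha_inv: "\<sigma> \<in> finite_perms \<Longrightarrow> \<alpha> \<sigma> (\<alpha> (inv \<sigma>) a) = a"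
proof -
  assume \<sigma>: "\<sigma> \<in> finite_perms"
  then have "\<sigma> \<circ> inv \<sigma> = id" by (simp add: finite_perms_def bij_is_surj flip: surj_iff)
  then show ?thesis
    using action_comp[OF \<sigma> inv_finite_perms[OF \<sigma>]] alpha_id by (auto dest: fun_cong[of _ _ a])
qed

text \<open>Disjointly supported translates of an odd element anticommute, which kills the cross terms in
  \<open>m\<^sup>* m + m m\<^sup>*\<close>.\<close>

lemma odd_average:
  assumes I: "finite I" and a: "a \<in> \<AA> I" "\<theta> a = - a"
  shows "\<exists>\<sigma> :: nat \<Rightarrow> nat \<Rightarrow> nat. (\<forall>k. \<sigma> k \<in> finite_perms) \<and>
    (\<forall>\<phi> n. positive_functional \<phi> \<longrightarrow> (\<forall>\<tau>\<in>finite_perms. \<forall>b. \<phi> (\<alpha> \<tau> b) = \<phi> b) \<longrightarrow>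
      Re (\<phi> (star (\<Sum>k<n. \<alpha> (\<sigma> k) a) * (\<Sum>k<n. \<alpha> (\<sigma> k) a)))
        \<le> real n * Re (\<phi> (star a * a + a * star a)))"
proof -
  obtain \<sigma> :: "nat \<Rightarrow> nat \<Rightarrow> nat" where \<sigma>: "\<And>k. \<sigma> k \<in> finite_perms"
    "\<And>k l. k \<noteq> l \<Longrightarrow> \<sigma> k ` I \<inter> \<sigma> l ` I = {}"
    using separating_perms[OF I] by metis
  define x where "x k = \<alpha> (\<sigma> k) a" for k
  have x: "x k \<in> \<AA> (\<sigma> k ` I)" "\<theta> (x k) = - x k" for k
    using alpha_local[OF \<sigma>(1) I a(1)] a(2) by (auto simp: x_def alpha_theta alpha_minus \<sigma>(1))
  have cross: "star (x j) * x k = - (x k * star (x j))" if "j \<noteq> k" for j k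
    using I x \<sigma>(2)[OF that]
    by (intro odd_anticommute[of "\<sigma> j ` I" "\<sigma> k ` I"] local_star) (auto simp: theta_star star_minus)
  have star_sum: "star (\<Sum>k<n. x k) = (\<Sum>k<n. star (x k))" for n
    by (induction n) (auto simp: star_add)
  have "Re (\<phi> (star (\<Sum>k<n. x k) * (\<Sum>k<n. x k))) \<le> real n * Re (\<phi> (star a * a + a * star a))"
    if \<phi>: "positive_functional \<phi>" and inv: "\<And>\<tau> b. \<tau> \<in> finite_perms \<Longrightarrow> \<phi> (\<alpha> \<tau> b) = \<phi> b" for \<phi> n
  proof -
    define s where "s = (\<Sum>k<n. x k)"
    \<comment> \<open>The second double sum is reindexed so that each pair \<open>(j, k)\<close>
      contributes an anticommutator; \<open>cross\<close> then leaves only the diagonal.\<close>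
    have "star s * s + s * star s = (\<Sum>j<n. \<Sum>k<n. star (x j) * x k + x k * star (x j))"
      unfolding s_def star_sum sum_product sum.distrib by (subst (2) sum.swap) simp
    also have "\<dots> = (\<Sum>j<n. \<Sum>k<n. if k = j then star (x j) * x j + x j * star (x j) else 0)"
      using cross by (intro sum.cong refl) auto
    also have "\<dots> = (\<Sum>j<n. \<alpha> (\<sigma> j) (star a * a + a * star a))"
      by (simp add: x_def alpha_add alpha_mult alpha_star \<sigma>(1))
    finally have "\<phi> (star s * s + s * star s) = of_nat n * \<phi> (star a * a + a * star a)"
      by (simp add: positive_functional_sum[OF \<phi>] inv \<sigma>(1))
    then have "Re (\<phi> (star s * s)) + Re (\<phi> (s * star s)) = real n * Re (\<phi> (star a * a + a * star a))"
      by (simp add: positive_functional_add[OF \<phi>] flip: plus_complex.simps)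
    moreover have "0 \<le> Re (\<phi> (s * star s))"
      using positive_functional_square(2)[OF \<phi>, of "star s"] by (simp add: star_star)
    ultimately show ?thesis unfolding s_def by linarith
  qed
  then show ?thesis using \<sigma>(1) unfolding x_def by (intro exI[of _ \<sigma>]) simp
qed

section \<open>Evenness of symmetric states\<close>

context
  fixes \<omega> :: "'a \<Rightarrow>\<^sub>L complex"
  assumes \<omega>: "\<omega> \<in> invariant_states \<alpha>"
begin

lemma invariant_state_positive: "positive_functional (blinfun_apply \<omega>)"
  using \<omega> by (simp add: invariant_states_def state_positive)

lemma invariant_state_one: "\<omega> 1 = 1"
  using \<omega> by (simp add: invariant_states_def state_def)

lemma invariant_state_alpha: "\<sigma> \<in> finite_perms \<Longrightarrow> \<omega> (\<alpha> \<sigma> a) = \<omega> a"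
  using \<omega> by (auto simp: invariant_states_def fun_eq_iff)

text \<open>A sum of \<open>n\<close> translates has value \<open>n\<close> times
  \<open>\<omega> a\<close>, whose squared modulus is at most linear in \<open>n\<close> by the
  Schwarz inequality and \<open>odd_average\<close>.\<close>

lemma invariant_state_odd:
  assumes I: "finite I" and a: "a \<in> \<AA> I" "\<theta> a = - a"
  shows "\<omega> a = 0"
proof -
  note \<phi> = invariant_state_positive
  obtain \<sigma> :: "nat \<Rightarrow> nat \<Rightarrow> nat" where \<sigma>: "\<And>k. \<sigma> k \<in> finite_perms"
    and bound: "\<And>\<phi> n. positive_functional \<phi> \<Longrightarrow> (\<And>\<tau> b. \<tau> \<in> finite_perms \<Longrightarrow> \<phi> (\<alpha> \<tau> b) = \<phi> b) \<Longrightarrow>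
      Re (\<phi> (star (\<Sum>k<n. \<alpha> (\<sigma> k) a) * (\<Sum>k<n. \<alpha> (\<sigma> k) a)))
        \<le> real n * Re (\<phi> (star a * a + a * star a))"
    using odd_average[OF I a] by blast
  define K where "K = Re (\<omega> (star a * a + a * star a))"
  have le: "Re (\<omega> (star (\<Sum>k<n. \<alpha> (\<sigma> k) a) * (\<Sum>k<n. \<alpha> (\<sigma> k) a))) \<le> real n * K" for n
    unfolding K_def by (rule bound[of "blinfun_apply \<omega>" n, OF \<phi>]) (rule invariant_state_alpha)
  have "(real (Suc n) * cmod (\<omega> a))\<^sup>2 \<le> real (Suc n) * K" for n
  proof -
    have "\<omega> (\<Sum>k<Suc n. \<alpha> (\<sigma> k) a) = of_nat (Suc n) * \<omega> a"
      by (subst positive_functional_sum[OF \<phi>]) (simp only: invariant_state_alpha \<sigma> sum_constant card_lessThan)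
    then show ?thesis
      using positive_functional_Schwarz[OF \<phi> invariant_state_one, of "\<Sum>k<Suc n. \<alpha> (\<sigma> k) a"]
        le[of "Suc n"] by (simp only: norm_mult norm_of_nat)
  qed
  then have "cmod (\<omega> a) = 0" by (rule zero_of_square_growth)
  then show ?thesis by simp
qed

text \<open>\<open>star_automorphism\<close> is an algebraic notion, so continuity of \<omega>
  composed with \<theta> is drawn from its being a normalised positive functional. It then suffices
  to compare on local elements, where \<open>a - \<theta> a\<close> is odd.\<close>

lemma invariant_state_even: "blinfun_apply \<omega> \<circ> \<theta> = blinfun_apply \<omega>"
proof
  note \<phi> = invariant_state_positive
  have "positive_functional (\<lambda>a. \<omega> (\<theta> a))"
    using \<phi> by (auto simp: positive_functional_def theta_add theta_scaleC theta_mult theta_star)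
  moreover have "\<omega> (\<theta> 1) = 1"
    using star_automorphism_one[OF grading(1)] by (simp add: invariant_state_one)
  ultimately have "cmod (\<omega> (\<theta> a)) \<le> norm a" for a
    by (rule positive_functional_contractive)
  then have "bounded_linear (\<lambda>a. \<omega> (\<theta> a))"
    by (intro bounded_linear_intro[where K = 1])
      (auto simp: theta_add theta_scaleR blinfun.add_right blinfun.scaleR_right)
  then have "closed {a. \<omega> (\<theta> a) = \<omega> a}"
    by (intro closed_Collect_eq linear_continuous_on blinfun.bounded_linear_right)
  moreover have "local_algebra \<subseteq> {a. \<omega> (\<theta> a) = \<omega> a}"
  proof
    fix a assume "a \<in> local_algebra"
    then obtain I where I: "finite I" "a \<in> \<AA> I" by (auto simp: local_algebra_def)
    have "\<omega> (a - \<theta> a) = 0"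
      by (rule invariant_state_odd[OF I(1)]) (simp_all add: I local_diff local_theta theta_diff theta_theta)
    then show "a \<in> {a. \<omega> (\<theta> a) = \<omega> a}" by (simp add: blinfun.diff_right)
  qed
  ultimately have "UNIV \<subseteq> {a. \<omega> (\<theta> a) = \<omega> a}"
    unfolding closure_local_algebra[symmetric] by (rule closure_minimal[rotated])
  then show "(blinfun_apply \<omega> \<circ> \<theta>) a = \<omega> a" for a by auto
qed

end

end

subsection \<open>Symmetric states and fixed vectors\<close>

locale invariant_gns = local_action \<theta> \<AA> \<alpha>
  for \<theta> :: "'a::unital_cstar_algebra \<Rightarrow> 'a" and \<AA> and \<alpha> +
  fixes \<omega> :: "'a \<Rightarrow>\<^sub>L complex" and \<pi> :: "'a \<Rightarrow> 'h::chilbert_space \<Rightarrow> 'h" and \<xi> :: 'h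
  assumes omega: "\<omega> \<in> invariant_states \<alpha>"
    and gns: "gns_triple \<omega> \<pi> \<xi>"
begin

abbreviation "U \<equiv> gns_unitary \<alpha> \<pi> \<xi>"
abbreviation "F \<equiv> fixed_vectors \<alpha> \<pi> \<xi>"
abbreviation "E \<equiv> fixed_proj \<alpha> \<pi> \<xi>"

lemma pi_add: "\<pi> (a + b) x = \<pi> a x + \<pi> b x"
  and pi_scaleC: "\<pi> (c *\<^sub>C a) x = c *\<^sub>C \<pi> a x"
  and pi_mult: "\<pi> (a * b) x = \<pi> a (\<pi> b x)"
  and pi_one: "\<pi> 1 x = x"
  and pi_star: "cinner (\<pi> (star a) x) y = cinner x (\<pi> a y)"
  and pi_add_vec: "\<pi> a (x + y) = \<pi> a x + \<pi> a y"
  and bounded_linear_pi_vec: "bounded_linear (\<pi> a)"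
  and omega_gns: "\<omega> a = cinner \<xi> (\<pi> a \<xi>)"
  using gns by (auto simp: gns_triple_def star_representation_def bounded_op_def clinear_iff)

lemma pi_scaleR: "\<pi> (r *\<^sub>R a) x = r *\<^sub>R \<pi> a x"
  using pi_scaleC[of "of_real r"] by (simp add: scaleC_of_real)

lemma pi_diff: "\<pi> (a - b) x = \<pi> a x - \<pi> b x"
  using pi_add[of "a - b" b x] by (simp add: algebra_simps)

lemma pi_diff_vec: "\<pi> a (x - y) = \<pi> a x - \<pi> a y"
  using pi_add_vec[of a "x - y" y] by (simp add: algebra_simps)

lemma pi_star': "cinner x (\<pi> (star a) y) = cinner (\<pi> a x) y"
  using pi_star[of "star a" x y] by (simp add: star_star)

lemma cinner_pi_square: "cinner x (\<pi> (star a * a) x) = of_real ((norm (\<pi> a x))\<^sup>2)"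
  by (simp add: pi_mult pi_star' cinner_self)

lemma vector_functional_positive: "positive_functional (\<lambda>a. cinner x (\<pi> a x))"
  unfolding positive_functional_def
  by (simp add: pi_add pi_scaleC cinner_add_right cinner_scaleC_right cinner_pi_square
      del: of_real_power)

text \<open>A representation consists of bounded operators, but a bound in terms of
  \<open>norm a\<close> is still to be found; it comes from the automatic bound on the positive
  functional of the vector \<open>x\<close>. Continuity of \<open>\<lambda>a. \<pi> a x\<close>
  rests on it.\<close>

lemma norm_pi_le: "norm (\<pi> a x) \<le> norm a * norm x"
proof -
  have "(norm (\<pi> a x))\<^sup>2 \<le> (norm a * norm x)\<^sup>2"
    using positive_functional_norm_le[OF vector_functional_positive, of x a]
    by (simp add: cinner_pi_square pi_one cinner_self power_mult_distrib del: of_real_power)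
  then show ?thesis by (rule power2_le_imp_le) simp
qed

lemma bounded_linear_pi: "bounded_linear (\<lambda>a. \<pi> a x)"
  by (rule bounded_linear_intro[where K = "norm x"]) (auto simp: pi_add pi_scaleR norm_pi_le)

lemma orbit_dense: "closure (range (\<lambda>a. \<pi> a \<xi>)) = UNIV"
  using gns by (simp add: gns_triple_def)

lemma orbit_induct:
  assumes "closed {x. P x}" "\<And>a. P (\<pi> a \<xi>)" shows "P x"
proof -
  have "closure (range (\<lambda>a. \<pi> a \<xi>)) \<subseteq> {x. P x}"
    using assms by (intro closure_minimal) auto
  then show ?thesis by (auto simp: orbit_dense)
qed

section \<open>The unitaries implementing the action\<close>

lemma orbit_cinner: "cinner (\<pi> a \<xi>) (\<pi> b \<xi>) = \<omega> (star a * b)"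
  by (simp add: omega_gns pi_mult pi_star')

lemma orbit_cinner_alpha:
  "\<sigma> \<in> finite_perms \<Longrightarrow> cinner (\<pi> (\<alpha> \<sigma> a) \<xi>) (\<pi> (\<alpha> \<sigma> b) \<xi>) = cinner (\<pi> a \<xi>) (\<pi> b \<xi>)"
  unfolding orbit_cinner by (metis alpha_mult alpha_star invariant_state_alpha[OF omega])

lemma orbit_norm_alpha: "\<sigma> \<in> finite_perms \<Longrightarrow> norm (\<pi> (\<alpha> \<sigma> a) \<xi>) = norm (\<pi> a \<xi>)"
  by (simp only: norm_eq_sqrt_cinner orbit_cinner_alpha)

text \<open>Invariance of \<omega> makes the prescription isometric on the orbit. This gives
  independence of the chosen preimage as well as uniform continuity, hence an extension to the
  closure.\<close>

lemma orbit_extension: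
  assumes \<sigma>: "\<sigma> \<in> finite_perms"
  obtains g where "continuous_on UNIV g" "\<And>a. g (\<pi> a \<xi>) = \<pi> (\<alpha> \<sigma> a) \<xi>"
proof -
  define D where "D = range (\<lambda>a. \<pi> a \<xi>)"
  define f where "f d = \<pi> (\<alpha> \<sigma> (inv_into UNIV (\<lambda>a. \<pi> a \<xi>) d)) \<xi>" for d
  \<comment> \<open>One identity serves twice: \<open>b = a\<close> says that the chosen preimage
    does not matter, and general \<open>b\<close> that distances are kept.\<close>
  have f: "norm (f (\<pi> a \<xi>) - \<pi> (\<alpha> \<sigma> b) \<xi>) = norm (\<pi> a \<xi> - \<pi> b \<xi>)" for a b
  proof -
    define a' where "a' = inv_into UNIV (\<lambda>a. \<pi> a \<xi>) (\<pi> a \<xi>)"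
    have "\<pi> a' \<xi> = \<pi> a \<xi>" unfolding a'_def by (rule f_inv_into_f) simp
    moreover have "norm (\<pi> (\<alpha> \<sigma> (a' - b)) \<xi>) = norm (\<pi> (a' - b) \<xi>)"
      by (rule orbit_norm_alpha[OF \<sigma>])
    ultimately show ?thesis by (simp add: f_def a'_def[symmetric] alpha_diff[OF \<sigma>] pi_diff)
  qed
  have fa: "f (\<pi> a \<xi>) = \<pi> (\<alpha> \<sigma> a) \<xi>" for a using f[of a a] by simp
  have "dist (f d) (f e) = dist d e" if "d \<in> D" "e \<in> D" for d e
    using that f by (auto simp: D_def dist_norm fa)
  then have "uniformly_continuous_on D f"
    unfolding uniformly_continuous_on_def by (metis (no_types, lifting))
  then obtain g where "uniformly_continuous_on (closure D) g" "\<And>x. x \<in> D \<Longrightarrow> f x = g x"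
    using uniformly_continuous_on_extension_on_closure[of D f] by metis
  then show ?thesis
    using that[of g] fa orbit_dense by (simp add: D_def uniformly_continuous_imp_continuous)
qed

text \<open>Only inner products and the inverse relation are transferred from the orbit by density.
  Surjectivity comes from the extension belonging to \<open>inv \<sigma>\<close>, and linearity
  follows from these two properties.\<close>

lemma unitary_exists:
  assumes \<sigma>: "\<sigma> \<in> finite_perms"
  shows "\<exists>V. unitary_op V \<and> (\<forall>a. V (\<pi> a \<xi>) = \<pi> (\<alpha> \<sigma> a) \<xi>)"
proof -
  obtain g where g: "continuous_on UNIV g" "\<And>a. g (\<pi> a \<xi>) = \<pi> (\<alpha> \<sigma> a) \<xi>"
    using orbit_extension[OF \<sigma>] by blast
  obtain h where h: "continuous_on UNIV h" "\<And>a. h (\<pi> a \<xi>) = \<pi> (\<alpha> (inv \<sigma>) a) \<xi>"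
    using orbit_extension[OF inv_finite_perms[OF \<sigma>]] by blast
  note cont = continuous_intros continuous_on_compose2[OF g(1)] continuous_on_compose2[OF h(1)]
  have "g (h x) = x" for x
    by (rule orbit_induct[of "\<lambda>x. g (h x) = x"])
      (auto simp: g(2) h(2) alpha_inv \<sigma> intro!: closed_Collect_eq cont)
  then have surj: "surj g" by (metis surjI)
  have inner1: "cinner (g (\<pi> a \<xi>)) (g y) = cinner (\<pi> a \<xi>) y" for a y
    by (rule orbit_induct[of "\<lambda>y. cinner (g (\<pi> a \<xi>)) (g y) = cinner (\<pi> a \<xi>) y"])
      (auto simp: g(2) orbit_cinner_alpha \<sigma> intro!: closed_Collect_eq cont)
  have inner: "cinner (g x) (g y) = cinner x y" for x y
    by (rule orbit_induct[of "\<lambda>x. cinner (g x) (g y) = cinner x y"])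
      (auto simp: inner1 intro!: closed_Collect_eq cont)
  \<comment> \<open>The defect of linearity is orthogonal to the range of \<open>g\<close>, which is
    the whole space.\<close>
  have lin: "g z = c *\<^sub>C g x + g y" if "z = c *\<^sub>C x + y" for c x y z
  proof -
    have "cinner (g w) (g z - (c *\<^sub>C g x + g y)) = 0" for w
      by (simp add: cinner_diff_right cinner_add_right cinner_scaleC_right inner that)
    then have "cinner v (g z - (c *\<^sub>C g x + g y)) = 0" for v using surj by (metis surjD)
    then show ?thesis using cinner_eq_zero_imp by (metis eq_iff_diff_eq_0)
  qed
  have zero: "g 0 = 0" using inner[of 0 0] by (simp add: cinner_self)
  have "g (x + y) = g x + g y" for x y using lin[of "x + y" 1 x y] by (simp add: scaleC_one)
  moreover have "g (c *\<^sub>C x) = c *\<^sub>C g x" for c x using lin[of "c *\<^sub>C x" c x 0] zero by simp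
  ultimately have clin: "clinear g" by (simp add: clinear_iff)
  have "norm (g x) = norm x" for x by (simp add: norm_eq_sqrt_cinner inner)
  then have "bounded_linear g"
    using clinear_imp_linear[OF clin]
    by (intro bounded_linear_intro[where K = 1]) (simp_all add: linear_add linear_cmul)
  with clin have "bounded_op g" by (simp add: bounded_op_def)
  then show ?thesis using surj inner g(2) by (auto simp: unitary_op_def)
qed

context
  fixes \<sigma> assumes \<sigma>: "\<sigma> \<in> finite_perms"
begin

text \<open>Bounded operators agreeing on the cyclic orbit agree everywhere, so the definite
  description denotes the operator just constructed.\<close>

lemma gns_unitary_spec: "unitary_op (U \<sigma>) \<and> (\<forall>a. U \<sigma> (\<pi> a \<xi>) = \<pi> (\<alpha> \<sigma> a) \<xi>)"
  unfolding gns_unitary_def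
proof (rule theI'[of "\<lambda>V. unitary_op V \<and> (\<forall>a. V (\<pi> a \<xi>) = \<pi> (\<alpha> \<sigma> a) \<xi>)"])
  show "\<exists>!V. unitary_op V \<and> (\<forall>a. V (\<pi> a \<xi>) = \<pi> (\<alpha> \<sigma> a) \<xi>)"
  proof (rule ex_ex1I[OF unitary_exists[OF \<sigma>]])
    fix W V
    assume V: "unitary_op V \<and> (\<forall>a. V (\<pi> a \<xi>) = \<pi> (\<alpha> \<sigma> a) \<xi>)"
      and W: "unitary_op W \<and> (\<forall>a. W (\<pi> a \<xi>) = \<pi> (\<alpha> \<sigma> a) \<xi>)"
    show "W = V"
    proof
      fix x
      have "bounded_linear V" "bounded_linear W"
        using V W by (auto simp: unitary_op_def bounded_op_def)
      then have "closed {x. W x = V x}"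
        by (intro closed_Collect_eq linear_continuous_on)
      then show "W x = V x" by (rule orbit_induct) (use V W in auto)
    qed
  qed
qed

lemma U_orbit: "U \<sigma> (\<pi> a \<xi>) = \<pi> (\<alpha> \<sigma> a) \<xi>"
  and U_cinner: "cinner (U \<sigma> x) (U \<sigma> y) = cinner x y"
  and U_bounded_linear: "bounded_linear (U \<sigma>)"
  and U_add: "U \<sigma> (x + y) = U \<sigma> x + U \<sigma> y"
  and U_scaleC: "U \<sigma> (c *\<^sub>C x) = c *\<^sub>C U \<sigma> x"
  using gns_unitary_spec by (auto simp: unitary_op_def bounded_op_def clinear_iff)

lemma U_diff: "U \<sigma> (x - y) = U \<sigma> x - U \<sigma> y"
  using U_bounded_linear by (simp add: linear_diff bounded_linear.linear)

lemma U_norm: "norm (U \<sigma> x) = norm x"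
  by (simp add: norm_eq_sqrt_cinner U_cinner)

lemma continuous_on_U: "continuous_on S f \<Longrightarrow> continuous_on S (\<lambda>x. U \<sigma> (f x))"
  by (rule bounded_linear.continuous_on[OF U_bounded_linear])

lemma U_pi: "U \<sigma> (\<pi> a x) = \<pi> (\<alpha> \<sigma> a) (U \<sigma> x)"
proof (rule orbit_induct[of "\<lambda>x. U \<sigma> (\<pi> a x) = \<pi> (\<alpha> \<sigma> a) (U \<sigma> x)"])
  show "U \<sigma> (\<pi> a (\<pi> b \<xi>)) = \<pi> (\<alpha> \<sigma> a) (U \<sigma> (\<pi> b \<xi>))" for b
    by (simp add: U_orbit alpha_mult[OF \<sigma>] flip: pi_mult)
qed (intro closed_Collect_eq continuous_on_U continuous_on_id
    bounded_linear.continuous_on[OF bounded_linear_pi_vec])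

lemma U_fixed: "x \<in> F \<Longrightarrow> U \<sigma> x = x"
  using \<sigma> by (simp add: fixed_vectors_def)

text \<open>The bridge between the two settings: on an invariant vector, translating the algebra
  element is the same as moving along an orbit in the Hilbert space.\<close>

lemma U_pi_fixed: "x \<in> F \<Longrightarrow> U \<sigma> (\<pi> a x) = \<pi> (\<alpha> \<sigma> a) x"
  by (simp add: U_pi U_fixed)

end

lemma U_comp:
  assumes \<sigma>: "\<sigma> \<in> finite_perms" and \<tau>: "\<tau> \<in> finite_perms"
  shows "U \<sigma> (U \<tau> x) = U (\<sigma> \<circ> \<tau>) x"
proof (rule orbit_induct[of "\<lambda>x. U \<sigma> (U \<tau> x) = U (\<sigma> \<circ> \<tau>) x"])
  show "U \<sigma> (U \<tau> (\<pi> a \<xi>)) = U (\<sigma> \<circ> \<tau>) (\<pi> a \<xi>)" for a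
    by (simp add: U_orbit \<sigma> \<tau> comp_finite_perms action_comp)
qed (intro closed_Collect_eq continuous_on_U continuous_on_id \<sigma> \<tau> comp_finite_perms)

section \<open>The fixed space and its projection\<close>

lemma cyclic_fixed: "\<xi> \<in> F"
  unfolding fixed_vectors_def
  using U_orbit[of _ 1] by (simp add: pi_one alpha_one)

lemma norm_cyclic: "norm \<xi> = 1"
  using invariant_state_one[OF omega] by (simp add: omega_gns pi_one norm_eq_sqrt_cinner)

lemma csubspace_fixed: "csubspace F"
  using linear_0[OF bounded_linear.linear[OF U_bounded_linear]]
  by (auto simp: csubspace_def fixed_vectors_def U_add U_scaleC)

lemma closed_fixed: "closed F"
proof -
  have "F = (\<Inter>\<sigma>\<in>finite_perms. {x. U \<sigma> x = x})" by (auto simp: fixed_vectors_def)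
  then show ?thesis
    by (simp only:) (intro closed_INT ballI closed_Collect_eq continuous_on_U continuous_on_id)
qed

lemma fixed_add: "x \<in> F \<Longrightarrow> y \<in> F \<Longrightarrow> x + y \<in> F"
  and fixed_scaleC: "x \<in> F \<Longrightarrow> c *\<^sub>C x \<in> F"
  using csubspace_fixed by (auto simp: csubspace_def)

lemma E_fixed: "E x \<in> F"
  unfolding fixed_proj_def by (rule orth_proj_mem[OF closed_fixed csubspace_fixed])

lemma cinner_fixed_E: "z \<in> F \<Longrightarrow> cinner z (E x) = cinner z x"
  using orth_proj_orthogonal[OF closed_fixed csubspace_fixed, of z x]
  by (simp add: fixed_proj_def cinner_diff_right)

lemma E_eqI: "y \<in> F \<Longrightarrow> (\<And>z. z \<in> F \<Longrightarrow> cinner z x = cinner z y) \<Longrightarrow> E x = y"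
  unfolding fixed_proj_def by (rule orth_proj_eqI[OF csubspace_fixed]) (auto simp: cinner_diff_right)

lemma E_id: "x \<in> F \<Longrightarrow> E x = x"
  by (rule E_eqI) auto

lemma cinner_E: "cinner (E x) y = cinner x (E y)"
proof -
  have "cinner (E x) y = cinner (E x) (E y)" by (simp add: cinner_fixed_E E_fixed)
  also have "\<dots> = cnj (cinner (E y) (E x))" by (rule cinner_commute)
  also have "\<dots> = cnj (cinner (E y) x)" by (simp add: cinner_fixed_E E_fixed)
  also have "\<dots> = cinner x (E y)" by (rule cinner_commute[symmetric])
  finally show ?thesis .
qed

lemma E_add: "E (x + y) = E x + E y"
  by (rule E_eqI) (auto simp: fixed_add E_fixed cinner_add_right cinner_fixed_E)

lemma E_scaleC: "E (c *\<^sub>C x) = c *\<^sub>C E x"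
  by (rule E_eqI) (auto simp: fixed_scaleC E_fixed cinner_scaleC_right cinner_fixed_E)

lemma norm_E_le: "norm (E x) \<le> norm x"
proof (cases "E x = 0")
  case False
  have "complex_of_real ((norm (E x))\<^sup>2) = cinner (E x) x"
    by (simp only: cinner_self[symmetric] cinner_fixed_E[OF E_fixed])
  then have "(norm (E x))\<^sup>2 = cmod (cinner (E x) x)"
    by (metis norm_of_real abs_power2)
  also have "\<dots> \<le> norm (E x) * norm x" by (rule norm_cinner_le)
  finally show ?thesis using False by (simp add: power2_eq_square)
qed simp

lemma bounded_linear_E: "bounded_linear E"
proof (rule bounded_linear_intro[where K = 1])
  show "E (r *\<^sub>R x) = r *\<^sub>R E x" for r x
    using E_scaleC[of "of_real r" x] by (simp add: scaleC_of_real)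
qed (auto simp: E_add norm_E_le)

text \<open>The Alaoglu--Birkhoff ergodic theorem for two orbits at once: the point of minimal norm of the
  closed convex hull is unique, hence fixed.\<close>

lemma mean_ergodic:
  "(E v, E w) \<in> closure (convex hull ((\<lambda>\<sigma>. (U \<sigma> v, U \<sigma> w)) ` finite_perms))"
proof -
  define X where "X = (\<lambda>\<sigma>. (U \<sigma> v, U \<sigma> w)) ` finite_perms"
  define K where "K = closure (convex hull X)"
  have "X \<noteq> {}" using id_finite_perms by (auto simp: X_def)
  then have K: "closed K" "convex K" "K \<noteq> {}"
    by (auto simp: K_def convex_closure convex_convex_hull)
  obtain p where p: "p \<in> K" "\<And>q. q \<in> K \<Longrightarrow> norm q = norm p \<Longrightarrow> q = p"
    using minimal_norm[OF parallelogram_Pair K] by auto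
  have "U \<tau> (fst p) = fst p \<and> U \<tau> (snd p) = snd p" if \<tau>: "\<tau> \<in> finite_perms" for \<tau>
  proof -
    \<comment> \<open>\<open>T\<close> maps the orbit of pairs into itself, hence also
      \<open>K\<close>, and preserves the product norm; uniqueness of the minimal point gives
      \<open>T p = p\<close>.\<close>
    define T where "T q = (U \<tau> (fst q), U \<tau> (snd q))" for q
    have T: "bounded_linear T"
      unfolding T_def
      by (rule bounded_linear_Pair[OF bounded_linear_compose[OF U_bounded_linear[OF \<tau>] bounded_linear_fst]
            bounded_linear_compose[OF U_bounded_linear[OF \<tau>] bounded_linear_snd]])
    have "T (U \<sigma> v, U \<sigma> w) \<in> X" if "\<sigma> \<in> finite_perms" for \<sigma>
      unfolding X_def using that \<tau>
      by (intro image_eqI[of _ _ "\<tau> \<circ> \<sigma>"]) (simp_all add: T_def U_comp comp_finite_perms)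
    then have "T ` X \<subseteq> X" by (auto simp: X_def)
    then have "T ` (convex hull X) \<subseteq> convex hull X"
      by (simp add: convex_hull_linear_image bounded_linear.linear[OF T] hull_mono)
    then have "T ` K \<subseteq> K"
      unfolding K_def using closure_subset
      by (intro image_closure_subset linear_continuous_on[OF T]) auto
    then have "T p \<in> K" using p(1) by blast
    moreover have "norm (T p) = norm p" by (simp add: norm_prod_def T_def U_norm \<tau>)
    ultimately have "T p = p" by (rule p(2))
    then show ?thesis by (simp add: T_def prod_eq_iff)
  qed
  then have F: "fst p \<in> F" "snd p \<in> F" by (simp_all add: fixed_vectors_def)
  have orth: "cinner z v = cinner z (fst p) \<and> cinner z w = cinner z (snd p)" if z: "z \<in> F" for z
  proof -
    \<comment> \<open>Pairing with an invariant \<open>z\<close> is constant along an orbit, hence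
      on its closed convex hull. This identifies the fixed point \<open>p\<close> as the pair of
      projections.\<close>
    define S where "S = {q. cinner z (fst q) = cinner z v \<and> cinner z (snd q) = cinner z w}"
    have "cinner z (U \<sigma> u) = cinner z u" if "\<sigma> \<in> finite_perms" for \<sigma> u
      using U_cinner[OF that, of z u] U_fixed[OF that z] by simp
    then have "X \<subseteq> S" by (auto simp: X_def S_def)
    moreover have "convex S"
      by (rule convexI) (simp add: S_def cinner_add_right cinner_scaleR_right
          flip: distrib_right of_real_add)
    moreover have "closed S"
      unfolding S_def by (intro closed_Collect_conj closed_Collect_eq continuous_intros)
    ultimately have "K \<subseteq> S" unfolding K_def by (intro closure_minimal hull_minimal)
    then show ?thesis using p(1) by (auto simp: S_def)
  qed
  have "E v = fst p" "E w = snd p" using F orth by (auto intro!: E_eqI)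
  then show ?thesis using p(1) by (simp add: K_def X_def)
qed

text \<open>The average comes from the mean ergodic theorem; a further translation, which fixes the
  limit, moves its support off \<open>J\<close>.\<close>

lemma even_average:
  assumes c: "c \<in> even_local" and xy: "x \<in> F" "y \<in> F" and J: "finite J" and e: "0 < e"
  obtains c' where "c' \<in> convex hull ((\<lambda>\<sigma>. \<alpha> \<sigma> c) ` finite_perms)"
    "\<And>a. a \<in> \<AA> J \<Longrightarrow> c' * a = a * c'"
    "norm (\<pi> c' x - E (\<pi> c x)) < e" "norm (\<pi> (star c') y - E (\<pi> (star c) y)) < e"
proof -
  define S where "S = (\<lambda>\<sigma>. \<alpha> \<sigma> c) ` finite_perms"
  \<comment> \<open>The second component controls the adjoint of the average. \<open>L\<close> is
    only real linear because \<open>star\<close> conjugates scalars, but that is enough to commute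
    with convex hulls.\<close>
  define L where "L b = (\<pi> b x, \<pi> (star b) y)" for b
  have "linear L"
    by (rule linearI) (auto simp: L_def star_add star_scaleR pi_add pi_scaleR)
  moreover have "(\<lambda>\<sigma>. (U \<sigma> (\<pi> c x), U \<sigma> (\<pi> (star c) y))) ` finite_perms = L ` S"
    unfolding S_def image_image using xy
    by (intro image_cong) (auto simp: L_def U_pi_fixed alpha_star)
  ultimately have "(E (\<pi> c x), E (\<pi> (star c) y)) \<in> closure (L ` (convex hull S))"
    using mean_ergodic[of "\<pi> c x" "\<pi> (star c) y"] by (simp add: convex_hull_linear_image)
  then obtain c0 where c0: "c0 \<in> convex hull S"
    and d: "dist (L c0) (E (\<pi> c x), E (\<pi> (star c) y)) < e"
    using e by (auto simp: closure_approachable)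
  have "S \<subseteq> even_local" using c by (auto simp: S_def alpha_even_local)
  then have "c0 \<in> even_local"
    using c0 hull_minimal[of S even_local convex] subspace_imp_convex[OF subspace_even_local] by blast
  then obtain J1 where J1: "finite J1" "c0 \<in> \<AA> J1" "\<theta> c0 = c0"
    by (auto simp: even_local_def local_algebra_def)
  obtain \<tau> where \<tau>: "\<tau> \<in> finite_perms" "\<tau> ` J1 \<inter> J = {}"
    using separating_perm[OF J1(1) J] by blast
  have near: "norm (\<pi> (\<alpha> \<tau> b) z - E u) = norm (\<pi> b z - E u)" if "z \<in> F" for b z u
    using U_norm[OF \<tau>(1), of "\<pi> b z - E u"] that
    by (simp add: U_diff[OF \<tau>(1)] U_pi_fixed[OF \<tau>(1)] U_fixed[OF \<tau>(1)] E_fixed)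
  show ?thesis
  proof
    have "\<alpha> \<tau> ` S \<subseteq> S"
      using action_comp \<tau>(1) comp_finite_perms by (auto simp: S_def fun_eq_iff image_iff) metis
    then have "\<alpha> \<tau> ` (convex hull S) \<subseteq> convex hull S"
      by (simp add: convex_hull_linear_image alpha_linear[OF \<tau>(1)] hull_mono)
    then show "\<alpha> \<tau> c0 \<in> convex hull ((\<lambda>\<sigma>. \<alpha> \<sigma> c) ` finite_perms)"
      using c0 unfolding S_def by blast
    show "\<alpha> \<tau> c0 * a = a * \<alpha> \<tau> c0" if "a \<in> \<AA> J" for a
      using J1 J \<tau> that by (intro even_commute[of "\<tau> ` J1" J]) (auto simp: alpha_local alpha_theta)
    show "norm (\<pi> (\<alpha> \<tau> c0) x - E (\<pi> c x)) < e"
      using dist_fst_le[of "L c0" "(E (\<pi> c x), E (\<pi> (star c) y))"] d xy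
      by (simp add: L_def dist_norm near)
    show "norm (\<pi> (star (\<alpha> \<tau> c0)) y - E (\<pi> (star c) y)) < e"
      using dist_snd_le[of "L c0" "(E (\<pi> c x), E (\<pi> (star c) y))"] d xy
      by (simp add: L_def dist_norm near alpha_star[OF \<tau>(1), symmetric])
  qed
qed

subsection \<open>Commuting compressions\<close>

text \<open>For \<open>y = z\<close> this provides invariant positive functionals, to which
  \<open>odd_average\<close> applies; for different vectors it evaluates sums of translates in
  matrix coefficients.\<close>

lemma fixed_functional_alpha:
  assumes "\<sigma> \<in> finite_perms" "y \<in> F" "z \<in> F"
  shows "cinner z (\<pi> (\<alpha> \<sigma> b) y) = cinner z (\<pi> b y)"
  using U_cinner[OF assms(1), of z "\<pi> b y"] U_fixed[OF assms(1,3)] U_pi_fixed[OF assms(1,2)]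
  by simp

text \<open>The growth argument of \<open>invariant_state_odd\<close> with two vectors: the
  functional of \<open>y\<close> bounds \<open>norm (\<pi> m y)\<close>, while the inner product
  with \<open>z\<close> grows linearly in the number of translates. As \<open>y\<close> has any
  norm, the functional is not normalised.\<close>

lemma odd_compress:
  assumes I: "finite I" and a: "a \<in> \<AA> I" "\<theta> a = - a" and y: "y \<in> F"
  shows "E (\<pi> a y) = 0"
proof (rule E_eqI)
  show "0 \<in> F" using csubspace_fixed by (simp add: csubspace_def)
  fix z assume z: "z \<in> F"
  obtain \<sigma> :: "nat \<Rightarrow> nat \<Rightarrow> nat" where \<sigma>: "\<And>k. \<sigma> k \<in> finite_perms"
    and bound: "\<And>\<phi> n. positive_functional \<phi> \<Longrightarrow> (\<forall>\<tau>\<in>finite_perms. \<forall>b. \<phi> (\<alpha> \<tau> b) = \<phi> b) \<Longrightarrow>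
      Re (\<phi> (star (\<Sum>k<n. \<alpha> (\<sigma> k) a) * (\<Sum>k<n. \<alpha> (\<sigma> k) a)))
        \<le> real n * Re (\<phi> (star a * a + a * star a))"
    using odd_average[OF I a] by blast
  define \<phi> where "\<phi> b = cinner y (\<pi> b y)" for b
  have pos: "positive_functional \<phi>"
    unfolding \<phi>_def by (rule vector_functional_positive)
  define K where "K = (norm z)\<^sup>2 * Re (\<phi> (star a * a + a * star a))"
  have "(real (Suc n) * cmod (cinner z (\<pi> a y)))\<^sup>2 \<le> real (Suc n) * K" for n
  proof -
    define m where "m = (\<Sum>k<Suc n. \<alpha> (\<sigma> k) a)"
    have "linear (\<lambda>b. cinner z (\<pi> b y))"
      by (intro bounded_linear.linear bounded_linear_compose[OF bounded_linear_cinner_right bounded_linear_pi])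
    then have "cinner z (\<pi> m y) = (\<Sum>k<Suc n. cinner z (\<pi> (\<alpha> (\<sigma> k) a) y))"
      unfolding m_def by (rule linear_sum)
    also have "\<dots> = of_nat (Suc n) * cinner z (\<pi> a y)"
      by (simp only: fixed_functional_alpha[OF \<sigma> y z] sum_constant card_lessThan)
    finally have "real (Suc n) * cmod (cinner z (\<pi> a y)) \<le> norm z * norm (\<pi> m y)"
      using norm_cinner_le[of z "\<pi> m y"] by (simp only: norm_mult norm_of_nat)
    then have "(real (Suc n) * cmod (cinner z (\<pi> a y)))\<^sup>2 \<le> (norm z)\<^sup>2 * (norm (\<pi> m y))\<^sup>2"
      unfolding power_mult_distrib[symmetric] by (rule power_mono) simp
    also have "(norm (\<pi> m y))\<^sup>2 = Re (\<phi> (star m * m))"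
      by (simp add: \<phi>_def cinner_pi_square del: of_real_power)
    also have "\<dots> \<le> real (Suc n) * Re (\<phi> (star a * a + a * star a))"
      unfolding m_def using y by (intro bound pos) (simp add: \<phi>_def fixed_functional_alpha)
    finally show ?thesis by (simp add: K_def mult_left_mono mult.left_commute)
  qed
  then have "cmod (cinner z (\<pi> a y)) = 0" by (rule zero_of_square_growth)
  then show "cinner z (\<pi> a y) = cinner z 0" by simp
qed

lemma norm_cinner_pi_le: "cmod (cinner x (\<pi> a y)) \<le> norm x * (norm a * norm y)"
  by (rule order_trans[OF norm_cinner_le mult_left_mono[OF norm_pi_le norm_ge_zero]])

text \<open>With an average \<open>b'\<close> of \<open>b\<close> commuting with \<open>a\<close>,
  \<open>cinner x (\<pi> a (E (\<pi> b y)))\<close> is close to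
  \<open>cinner x (\<pi> (a * b') y)\<close>, which equals
  \<open>cinner (\<pi> (star b') x) (\<pi> a y)\<close>; the latter is close to
  \<open>cinner (E (\<pi> (star b) x)) (\<pi> a y)\<close>, the right side.\<close>

lemma commute_even:
  assumes I: "finite I" and a: "a \<in> \<AA> I" and b: "b \<in> even_local" and xy: "x \<in> F" "y \<in> F"
  shows "cinner x (\<pi> a (E (\<pi> b y))) = cinner x (\<pi> b (E (\<pi> a y)))" (is "?l = ?r")
proof -
  \<comment> \<open>The sum of the factors by which the two approximation errors are multiplied.
    Dividing by \<open>K + 1\<close> below also covers \<open>K = 0\<close>.\<close>
  define K where "K = norm x * norm a + norm (\<pi> a y)"
  have K: "0 \<le> K" by (simp add: K_def)
  have "cmod (?l - ?r) \<le> 0 + e" if e: "0 < e" for e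
  proof -
    define d where "d = e / (K + 1)"
    have d: "0 < d" using e K by (simp add: d_def)
    obtain b' where b': "\<And>a. a \<in> \<AA> I \<Longrightarrow> b' * a = a * b'"
      "norm (\<pi> b' y - E (\<pi> b y)) < d" "norm (\<pi> (star b') x - E (\<pi> (star b) x)) < d"
      using even_average[OF b xy(2) xy(1) I d] by metis
    have "cmod (?l - cinner x (\<pi> a (\<pi> b' y))) \<le> norm x * (norm a * norm (E (\<pi> b y) - \<pi> b' y))"
      using norm_cinner_pi_le[of x a "E (\<pi> b y) - \<pi> b' y"]
      by (simp only: cinner_diff_right pi_diff_vec)
    also have "\<dots> \<le> norm x * (norm a * d)"
      using b'(2) by (intro mult_left_mono) (simp_all add: norm_minus_commute)
    finally have 1: "cmod (?l - cinner x (\<pi> a (\<pi> b' y))) \<le> norm x * (norm a * d)" .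
    have "cinner x (\<pi> a (\<pi> b' y)) = cinner x (\<pi> (b' * a) y)"
      by (simp only: b'(1)[OF a] pi_mult)
    also have "\<dots> = cinner (\<pi> (star b') x) (\<pi> a y)" by (simp only: pi_star pi_mult)
    finally have "cinner x (\<pi> a (\<pi> b' y)) - ?r =
        cinner (\<pi> (star b') x - E (\<pi> (star b) x)) (\<pi> a y)"
      by (simp only: cinner_diff_left cinner_E pi_star)
    then have "cmod (cinner x (\<pi> a (\<pi> b' y)) - ?r) \<le>
        norm (\<pi> (star b') x - E (\<pi> (star b) x)) * norm (\<pi> a y)"
      by (simp only: norm_cinner_le)
    also have "\<dots> \<le> d * norm (\<pi> a y)"
      using b'(3) by (intro mult_right_mono) simp_all
    finally have "cmod (?l - ?r) \<le> norm x * (norm a * d) + d * norm (\<pi> a y)"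
      by (rule norm_diff_triangle_le[OF 1])
    also have "\<dots> = K * d" by (simp add: K_def algebra_simps)
    also have "\<dots> \<le> (K + 1) * d" using d by (simp add: distrib_right)
    also have "\<dots> = e" using K by (simp add: d_def)
    finally show ?thesis by simp
  qed
  then have "cmod (?l - ?r) \<le> 0" by (rule field_le_epsilon)
  then show ?thesis by simp
qed

text \<open>Parity is asked of one factor only in \<open>commute_even\<close>, so splitting
  \<open>b\<close> suffices. Its odd part drops out on both sides, on the right because
  \<open>E\<close> may be inserted next to the invariant vector \<open>x\<close>.\<close>

lemma commute_local:
  assumes I: "finite I" "a \<in> \<AA> I" and J: "finite J" "b \<in> \<AA> J" and xy: "x \<in> F" "y \<in> F"
  shows "cinner x (\<pi> a (E (\<pi> b y))) = cinner x (\<pi> b (E (\<pi> a y)))"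
proof -
  obtain b0 b1 where b: "b = b0 + b1" "b0 \<in> \<AA> J" "\<theta> b0 = b0" "b1 \<in> \<AA> J" "\<theta> b1 = - b1"
    using parity_decomposition[OF J] by metis
  have "E (\<pi> b1 z) = 0" if "z \<in> F" for z by (rule odd_compress[OF J(1) b(4,5) that])
  then have *: "E (\<pi> b z) = E (\<pi> b0 z)" if "z \<in> F" for z
    using that by (simp add: b(1) pi_add E_add)
  have "cinner x (\<pi> b (E (\<pi> a y))) = cinner x (\<pi> b0 (E (\<pi> a y)))"
    using cinner_fixed_E[OF xy(1)] *[OF E_fixed] by metis
  moreover have "b0 \<in> even_local"
    using b local_algebraI[OF J(1)] by (simp add: even_local_def)
  ultimately show ?thesis
    using commute_even[OF I _ xy] *[OF xy(2)] by simp
qed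

lemma compression_commute:
  assumes xy: "x \<in> F" "y \<in> F"
  shows "cinner x (\<pi> a (E (\<pi> b y))) = cinner x (\<pi> b (E (\<pi> a y)))"
proof -
  note bl = bounded_linear_compose[OF bounded_linear_cinner_right]
  have cont: "continuous_on UNIV (\<lambda>a. cinner x (\<pi> a u))"
    "continuous_on UNIV (\<lambda>a. cinner x (\<pi> b (E (\<pi> a y))))" for b u
    by (rule linear_continuous_on[OF bl[OF bounded_linear_pi]]
        linear_continuous_on[OF bl[OF bounded_linear_compose[OF bounded_linear_pi_vec
            bounded_linear_compose[OF bounded_linear_E bounded_linear_pi]]]])+
  have dense: "P a" if "closed {a. P a}" "\<And>I a. finite I \<Longrightarrow> a \<in> \<AA> I \<Longrightarrow> P a" for P and a :: 'a
  proof -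
    have "closure local_algebra \<subseteq> {a. P a}"
      using that by (intro closure_minimal) (auto simp: local_algebra_def)
    then show ?thesis by (auto simp: closure_local_algebra)
  qed
  \<comment> \<open>Density is used in one variable at a time: here \<open>a\<close> is local and
    \<open>b\<close> becomes arbitrary, after which \<open>a\<close> is freed.\<close>
  have "cinner x (\<pi> a (E (\<pi> b y))) = cinner x (\<pi> b (E (\<pi> a y)))"
    if "finite I" "a \<in> \<AA> I" for a I
    by (rule dense[of "\<lambda>b. cinner x (\<pi> a (E (\<pi> b y))) = cinner x (\<pi> b (E (\<pi> a y)))"])
      (rule closed_Collect_eq[OF cont(2) cont(1)], rule commute_local[OF that _ _ xy])
  then show ?thesis
    by (rule dense[of "\<lambda>a. cinner x (\<pi> a (E (\<pi> b y))) = cinner x (\<pi> b (E (\<pi> a y)))",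
        OF closed_Collect_eq[OF cont(1) cont(2)]])
qed

lemma compressed_algebra_commuting: "commuting_family (compressed_algebra \<alpha> \<pi> \<xi>)"
proof -
  have "E (\<pi> a (E (\<pi> b (E x)))) = E (\<pi> b (E (\<pi> a (E x))))" for a b x
    by (rule E_eqI) (simp_all add: E_fixed cinner_fixed_E compression_commute)
  then show ?thesis
    by (auto simp: commuting_family_def compressed_algebra_def fun_eq_iff E_id E_fixed)
qed

subsection \<open>Extreme symmetric states\<close>

text \<open>A hands-on Radon-Nikodym argument: \<omega>1 is represented by the component \<eta> of
  \<xi> orthogonal to the vectors coming from the kernel of \<omega>1. Domination makes \<eta>
  nonzero, invariance of \<omega>1 makes it fixed, and a multiple of \<xi> can only represent a
  multiple of \<omega>.\<close>

lemma dominated_invariant_state: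
  assumes one_dim: "F \<subseteq> range (\<lambda>c. c *\<^sub>C \<xi>)"
    and \<omega>1: "\<omega>1 \<in> invariant_states \<alpha>" and t: "0 < t"
    and le: "\<And>a. t * Re (\<omega>1 (star a * a)) \<le> Re (\<omega> (star a * a))"
  shows "\<omega>1 = \<omega>"
proof -
  note pos = invariant_state_positive[OF \<omega>1]
  define Z where "Z = {\<pi> b \<xi> |b. \<omega>1 b = 0}"
  define N where "N = closure Z"
  have "csubspace Z"
    unfolding csubspace_def
  proof (intro conjI ballI allI)
    show "0 \<in> Z" using pi_scaleC[of 0 0 \<xi>] by (auto simp: Z_def intro!: exI[of _ 0])
    show "x + y \<in> Z" if "x \<in> Z" "y \<in> Z" for x y
    proof -
      obtain b c where "x = \<pi> b \<xi>" "\<omega>1 b = 0" "y = \<pi> c \<xi>" "\<omega>1 c = 0" using \<open>x \<in> Z\<close> \<open>y \<in> Z\<close>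
        unfolding Z_def by blast
      then show ?thesis
        unfolding Z_def by (auto simp: pi_add blinfun.add_right intro!: exI[of _ "b + c"])
    qed
    show "c *\<^sub>C x \<in> Z" if "x \<in> Z" for c x
    proof -
      obtain b where "x = \<pi> b \<xi>" "\<omega>1 b = 0" using \<open>x \<in> Z\<close> unfolding Z_def by blast
      then show ?thesis
        unfolding Z_def
        by (auto simp: pi_scaleC positive_functional_scaleC[OF pos] intro!: exI[of _ "c *\<^sub>C b"])
    qed
  qed
  then have N: "closed N" "csubspace N" by (auto simp: N_def csubspace_closure)
  \<comment> \<open>On the kernel, \<open>1 - b\<close> has value 1 under \<omega>1, so its square
    has value at least 1 by Schwarz; domination turns this into a distance from \<xi>, and the bound
    survives the closure.\<close>
  have far: "t \<le> (norm (\<xi> - x))\<^sup>2" if "x \<in> N" for x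
  proof -
    have "t \<le> (norm (\<xi> - \<pi> b \<xi>))\<^sup>2" if b: "\<omega>1 b = 0" for b
    proof -
      have "\<omega>1 (1 - b) = 1" by (simp add: blinfun.diff_right b invariant_state_one[OF \<omega>1])
      then have "1 \<le> Re (\<omega>1 (star (1 - b) * (1 - b)))"
        using positive_functional_Schwarz[OF pos invariant_state_one[OF \<omega>1], of "1 - b"] by simp
      then have "t * 1 \<le> t * Re (\<omega>1 (star (1 - b) * (1 - b)))" using t by (intro mult_left_mono) auto
      also have "\<dots> \<le> Re (\<omega> (star (1 - b) * (1 - b)))" by (rule le)
      also have "\<dots> = (norm (\<xi> - \<pi> b \<xi>))\<^sup>2"
        by (simp only: omega_gns cinner_pi_square Re_complex_of_real pi_diff pi_one)
      finally show ?thesis by simp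
    qed
    then have "Z \<subseteq> {x. t \<le> (norm (\<xi> - x))\<^sup>2}" by (auto simp: Z_def)
    moreover have "closed {x. t \<le> (norm (\<xi> - x))\<^sup>2}"
      by (intro closed_Collect_le continuous_intros)
    ultimately have "N \<subseteq> {x. t \<le> (norm (\<xi> - x))\<^sup>2}" unfolding N_def by (rule closure_minimal)
    then show ?thesis using that by blast
  qed
  define \<eta> where "\<eta> = \<xi> - orth_proj N \<xi>"
  have "t \<le> (norm \<eta>)\<^sup>2" unfolding \<eta>_def by (rule far[OF orth_proj_mem[OF N]])
  then have \<eta>0: "\<eta> \<noteq> 0" using t by auto
  have orth: "cinner \<eta> z = 0" if "z \<in> N" for z
    using orth_proj_orthogonal[OF N that, of \<xi>] by (subst cinner_commute) (simp add: \<eta>_def)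
  have \<eta>: "cinner \<eta> (\<pi> b \<xi>) = \<omega>1 b * cinner \<eta> \<xi>" for b
  proof -
    \<comment> \<open>Subtracting the multiple of the unit puts \<open>b\<close> into the kernel, so
      pairing with \<eta> sees only \<open>\<omega>1 b\<close>.\<close>
    have "\<omega>1 (b - \<omega>1 b *\<^sub>C 1) = 0"
      by (simp add: positive_functional_diff[OF pos] positive_functional_scaleC[OF pos]
          invariant_state_one[OF \<omega>1])
    then have "\<pi> (b - \<omega>1 b *\<^sub>C 1) \<xi> \<in> Z" unfolding Z_def by blast
    then have "\<pi> (b - \<omega>1 b *\<^sub>C 1) \<xi> \<in> N" unfolding N_def by (rule subsetD[OF closure_subset])
    then have "cinner \<eta> (\<pi> (b - \<omega>1 b *\<^sub>C 1) \<xi>) = 0" by (rule orth)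
    then show ?thesis
      by (simp add: pi_diff pi_scaleC pi_one cinner_diff_right cinner_scaleC_right)
  qed
  have "U \<sigma> \<eta> = \<eta>" if \<sigma>: "\<sigma> \<in> finite_perms" for \<sigma>
  proof (rule cinner_eq_on_dense[OF orbit_dense])
    fix z assume "z \<in> range (\<lambda>a. \<pi> a \<xi>)"
    then obtain b where z: "z = \<pi> b \<xi>" by blast
    have "z = U \<sigma> (\<pi> (\<alpha> (inv \<sigma>) b) \<xi>)" by (simp add: z U_orbit \<sigma> alpha_inv)
    then have "cinner (U \<sigma> \<eta>) z = \<omega>1 (\<alpha> (inv \<sigma>) b) * cinner \<eta> \<xi>"
      by (simp only: U_cinner[OF \<sigma>] \<eta>)
    also have "\<dots> = cinner \<eta> z"
      by (simp only: z \<eta> invariant_state_alpha[OF \<omega>1 inv_finite_perms[OF \<sigma>]])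
    finally show "cinner (U \<sigma> \<eta>) z = cinner \<eta> z" .
  qed
  then have "\<eta> \<in> F" by (simp add: fixed_vectors_def)
  then obtain c where c: "\<eta> = c *\<^sub>C \<xi>" using one_dim by blast
  then have "c \<noteq> 0" using \<eta>0 by auto
  have "cnj c * \<omega> b = \<omega>1 b * cnj c" for b
    using \<eta>[of b] by (simp add: c cinner_scaleC_left omega_gns[symmetric] cinner_self norm_cyclic)
  then show ?thesis using \<open>c \<noteq> 0\<close> by (intro blinfun_eqI) simp
qed

text \<open>In a proper convex decomposition \<omega> dominates \<open>1 - u\<close> times
  \<omega>1, which forces \<omega>1, and then also \<omega>2, to be \<omega>.\<close>

lemma extreme_if_one_dim:
  assumes one_dim: "F \<subseteq> range (\<lambda>c. c *\<^sub>C \<xi>)"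
  shows "\<omega> extreme_point_of invariant_states \<alpha>"
  unfolding extreme_point_of_def
proof (intro conjI ballI omega notI)
  fix \<omega>1 \<omega>2 assume \<omega>1: "\<omega>1 \<in> invariant_states \<alpha>" and \<omega>2: "\<omega>2 \<in> invariant_states \<alpha>"
    and "\<omega> \<in> open_segment \<omega>1 \<omega>2"
  then obtain u where u: "\<omega>1 \<noteq> \<omega>2" "0 < u" "u < 1" "\<omega> = (1 - u) *\<^sub>R \<omega>1 + u *\<^sub>R \<omega>2"
    by (auto simp: in_segment)
  have "(1 - u) * Re (\<omega>1 (star a * a)) \<le> Re (\<omega> (star a * a))" for a
    using positive_functional_square(2)[OF invariant_state_positive[OF \<omega>2], of a] u(2)
    by (simp add: u(4) blinfun.add_left blinfun.scaleR_left)
  then have eq: "\<omega>1 = \<omega>"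
    using u(3) by (intro dominated_invariant_state[OF one_dim \<omega>1]) auto
  have "u *\<^sub>R (\<omega>2 - \<omega>1) = ((1 - u) *\<^sub>R \<omega>1 + u *\<^sub>R \<omega>2) - \<omega>1" by (simp add: algebra_simps)
  also have "\<dots> = 0" unfolding u(4)[symmetric] by (simp add: eq)
  finally have "u *\<^sub>R (\<omega>2 - \<omega>1) = 0" .
  then show False using u(1,2) by simp
qed

text \<open>Positivity has to be assumed: for \<eta> other than \<xi> the functional is a matrix
  coefficient, not visibly positive. Invariance comes from \<eta> being fixed.\<close>

lemma vector_state:
  assumes \<eta>: "\<eta> \<in> F" "cinner \<eta> \<xi> = 1"
    and pos: "\<And>a. cinner \<eta> (\<pi> (star a * a) \<xi>) \<in> \<real>\<^sub>\<ge>\<^sub>0"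
  obtains \<omega>' where "\<omega>' \<in> invariant_states \<alpha>" "\<And>a. blinfun_apply \<omega>' a = cinner \<eta> (\<pi> a \<xi>)"
proof
  have "bounded_linear (\<lambda>a. cinner \<eta> (\<pi> a \<xi>))"
    by (rule bounded_linear_compose[OF bounded_linear_cinner_right bounded_linear_pi])
  then show *: "blinfun_apply (Blinfun (\<lambda>a. cinner \<eta> (\<pi> a \<xi>))) a = cinner \<eta> (\<pi> a \<xi>)" for a
    by (simp add: bounded_linear_Blinfun_apply)
  show "Blinfun (\<lambda>a. cinner \<eta> (\<pi> a \<xi>)) \<in> invariant_states \<alpha>"
    using \<eta> pos fixed_functional_alpha[OF _ cyclic_fixed \<eta>(1)]
    by (simp add: invariant_states_def state_def cfunctional_iff fun_eq_iff * pi_add pi_scaleC pi_one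
        cinner_add_right cinner_scaleC_right)
qed

text \<open>If an average \<open>c'\<close> of \<open>star b * b\<close> commutes with
  \<open>a\<close>, then \<open>cinner (\<pi> c' \<xi>) (\<pi> (star a * a) \<xi>)\<close> equals
  \<open>cinner (\<pi> c' (\<pi> a \<xi>)) (\<pi> a \<xi>)\<close>, and \<open>c'\<close> acts as a
  positive operator. The hypothesis concerns the square alone, since the series root is not known to
  be local.\<close>

lemma compression_positive:
  assumes c: "star b * b \<in> even_local"
  shows "cinner (E (\<pi> (star b * b) \<xi>)) (\<pi> (star a * a) \<xi>) \<in> \<real>\<^sub>\<ge>\<^sub>0"
proof -
  define c where "c = star b * b"
  \<comment> \<open>Convex combinations of squares are not visibly squares, so positivity is carried
    as a convex condition on the represented operators.\<close>
  define P where "P = {d. \<forall>x. cinner (\<pi> d x) x \<in> \<real>\<^sub>\<ge>\<^sub>0}"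
  have "\<alpha> \<sigma> c \<in> P" if \<sigma>: "\<sigma> \<in> finite_perms" for \<sigma>
  proof -
    have "cinner (\<pi> (\<alpha> \<sigma> c) x) x = of_real ((norm (\<pi> (\<alpha> \<sigma> b) x))\<^sup>2)" for x
      by (simp only: c_def alpha_mult[OF \<sigma>] alpha_star[OF \<sigma>] pi_mult pi_star cinner_self)
    then show ?thesis by (simp add: P_def del: of_real_power)
  qed
  moreover have "convex P"
    by (rule convexI) (auto simp: P_def pi_add pi_scaleR cinner_add_left cinner_scaleR_left
        intro!: nonneg_Reals_add_I nonneg_Reals_mult_I)
  ultimately have P: "convex hull ((\<lambda>\<sigma>. \<alpha> \<sigma> c) ` finite_perms) \<subseteq> P"
    by (intro hull_minimal) auto
  have loc: "cinner (E (\<pi> c \<xi>)) (\<pi> (star a * a) \<xi>) \<in> \<real>\<^sub>\<ge>\<^sub>0" if J: "finite J" "a \<in> \<AA> J" for J a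
  proof -
    define w where "w = \<pi> (star a * a) \<xi>"
    have "\<exists>y\<in>\<real>\<^sub>\<ge>\<^sub>0. dist y (cinner (E (\<pi> c \<xi>)) w) < e" if e: "0 < e" for e
    proof -
      define d where "d = e / (norm w + 1)"
      have d: "0 < d" "d * (norm w + 1) = e"
        using e add_nonneg_pos[OF norm_ge_zero[of w] zero_less_one] by (simp_all add: d_def)
      obtain c' where c': "c' \<in> convex hull ((\<lambda>\<sigma>. \<alpha> \<sigma> c) ` finite_perms)"
        "\<And>a. a \<in> \<AA> J \<Longrightarrow> c' * a = a * c'" "norm (\<pi> c' \<xi> - E (\<pi> c \<xi>)) < d"
        using even_average[OF c[folded c_def] cyclic_fixed cyclic_fixed J(1) d(1)] by metis
      have "cinner (\<pi> c' \<xi>) w = cinner (\<pi> (a * c') \<xi>) (\<pi> a \<xi>)"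
        by (simp only: w_def pi_mult pi_star')
      also have "\<dots> = cinner (\<pi> c' (\<pi> a \<xi>)) (\<pi> a \<xi>)"
        by (simp only: c'(2)[OF J(2), symmetric] pi_mult)
      also have "\<dots> \<in> \<real>\<^sub>\<ge>\<^sub>0" using c'(1) P by (auto simp: P_def)
      finally have "cinner (\<pi> c' \<xi>) w \<in> \<real>\<^sub>\<ge>\<^sub>0" .
      moreover have "dist (cinner (\<pi> c' \<xi>) w) (cinner (E (\<pi> c \<xi>)) w) < e"
      proof -
        have "dist (cinner (\<pi> c' \<xi>) w) (cinner (E (\<pi> c \<xi>)) w) \<le>
            norm (\<pi> c' \<xi> - E (\<pi> c \<xi>)) * norm w"
          unfolding dist_norm cinner_diff_left[symmetric] by (rule norm_cinner_le)
        also have "\<dots> \<le> d * norm w" using c'(3) by (intro mult_right_mono) auto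
        also have "\<dots> < e" using d by (simp add: distrib_left)
        finally show ?thesis .
      qed
      ultimately show ?thesis by blast
    qed
    then show ?thesis
      using closed_approachable[OF closed_nonneg_Reals_complex] unfolding w_def by blast
  qed
  have "closed ((\<lambda>a. cinner (E (\<pi> c \<xi>)) (\<pi> (star a * a) \<xi>)) -` \<real>\<^sub>\<ge>\<^sub>0)"
    by (intro closed_vimage closed_nonneg_Reals_complex continuous_on_mult continuous_on_id
        bounded_linear.continuous_on[OF bounded_linear_compose[OF bounded_linear_cinner_right bounded_linear_pi]]
        linear_continuous_on[OF bounded_linear_star])
  then have "closure local_algebra \<subseteq> (\<lambda>a. cinner (E (\<pi> c \<xi>)) (\<pi> (star a * a) \<xi>)) -` \<real>\<^sub>\<ge>\<^sub>0"
    by (rule closure_minimal[rotated]) (use loc in \<open>auto simp: local_algebra_def\<close>)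
  then show ?thesis unfolding c_def by (auto simp: closure_local_algebra)
qed

text \<open>Since \<xi> is fixed, the perturbed vector is \<open>E (\<pi> (1 + h) \<xi>)\<close>,
  and \<open>1 + h\<close> is a square by \<open>sqrt_one_minus\<close> at
  \<open>- h\<close>.\<close>

lemma perturbation_positive:
  assumes h: "h \<in> even_local" "star h = h" "norm h < 1"
  shows "cinner (\<xi> + E (\<pi> h \<xi>)) (\<pi> (star a * a) \<xi>) \<in> \<real>\<^sub>\<ge>\<^sub>0"
proof -
  obtain b where "star b * b = 1 - (- h)"
    using sqrt_one_minus[of "- h"] h by (auto simp: star_minus)
  then have b: "star b * b = 1 + h" by simp
  have "1 + h \<in> even_local"
    by (rule subspace_add[OF subspace_even_local one_even_local h(1)])
  then show ?thesis
    using compression_positive[of b a] unfolding b by (simp add: pi_add pi_one E_add E_id cyclic_fixed)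
qed

lemma extreme_compression_small:
  assumes ext: "\<omega> extreme_point_of invariant_states \<alpha>"
    and h: "h \<in> even_local" "star h = h" "norm h < 1"
  shows "E (\<pi> h \<xi>) = \<omega> h *\<^sub>C \<xi>"
proof -
  note pos = invariant_state_positive[OF omega]
  define \<eta> where "\<eta> = E (\<pi> h \<xi>)"
  define t where "t = Re (\<omega> h)"
  have t: "\<omega> h = of_real t"
    using positive_functional_star[OF pos, of h] h(2) by (simp add: t_def complex_eq_iff)
  have "\<bar>t\<bar> < 1"
    using positive_functional_contractive[OF pos invariant_state_one[OF omega], of h] h(3)
    by (simp add: t)
  then have t1: "0 < 1 + t" "0 < 1 - t" by auto
  have \<eta>: "cinner \<eta> \<xi> = of_real t"
    unfolding \<eta>_def using cinner_E[of "\<pi> h \<xi>" \<xi>] pi_star[of h \<xi> \<xi>]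
    by (simp add: E_id cyclic_fixed h(2) flip: omega_gns t)
  have \<eta>F: "\<eta> \<in> F" by (simp add: \<eta>_def E_fixed)
  have \<xi>\<xi>: "cinner \<xi> \<xi> = 1" by (simp add: cinner_self norm_cyclic)
  have state: "\<exists>\<omega>'\<in>invariant_states \<alpha>. \<forall>a. blinfun_apply \<omega>' a = of_real (1 / (1 + s * t)) * cinner (\<xi> + s *\<^sub>R \<eta>) (\<pi> a \<xi>)"
    if s: "\<bar>s\<bar> = 1" for s :: real
  proof -
    \<comment> \<open>The normalisation, as \<open>cinner (\<xi> + s *\<^sub>R \<eta>) \<xi>\<close>
      is \<open>1 + s * t\<close>; this is positive for both signs because the modulus of
      \<open>t\<close> is below 1.\<close>
    define k where "k = 1 / (1 + s * t)"
    have st: "0 < 1 + s * t" using t1 s by (auto simp: abs_if split: if_splits)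
    then have k: "0 < k" "k * (1 + s * t) = 1" by (auto simp: k_def)
    have "s *\<^sub>R h \<in> even_local" "star (s *\<^sub>R h) = s *\<^sub>R h" "norm (s *\<^sub>R h) < 1"
      using h s subspace_scale[OF subspace_even_local] by (auto simp: star_scaleR)
    then have "cinner (\<xi> + E (\<pi> (s *\<^sub>R h) \<xi>)) (\<pi> (star a * a) \<xi>) \<in> \<real>\<^sub>\<ge>\<^sub>0" for a
      by (rule perturbation_positive)
    moreover have "E (\<pi> (s *\<^sub>R h) \<xi>) = s *\<^sub>R \<eta>"
      by (simp add: \<eta>_def pi_scaleR linear_cmul bounded_linear.linear[OF bounded_linear_E])
    ultimately have "cinner (k *\<^sub>R (\<xi> + s *\<^sub>R \<eta>)) (\<pi> (star a * a) \<xi>) \<in> \<real>\<^sub>\<ge>\<^sub>0" for a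
      using k(1) by (simp add: cinner_scaleR_left nonneg_Reals_mult_I)
    moreover have "k *\<^sub>R (\<xi> + s *\<^sub>R \<eta>) \<in> F"
      using \<eta>F cyclic_fixed csubspace_imp_subspace[OF csubspace_fixed]
      by (intro subspace_scale subspace_add) auto
    moreover have "cinner (k *\<^sub>R (\<xi> + s *\<^sub>R \<eta>)) \<xi> = 1"
    proof -
      have "cinner (k *\<^sub>R (\<xi> + s *\<^sub>R \<eta>)) \<xi> = of_real (k * (1 + s * t))"
        by (simp add: cinner_scaleR_left cinner_add_left \<xi>\<xi> \<eta>)
      then show ?thesis by (simp add: k(2))
    qed
    ultimately obtain \<omega>' where "\<omega>' \<in> invariant_states \<alpha>"
      "\<And>a. blinfun_apply \<omega>' a = cinner (k *\<^sub>R (\<xi> + s *\<^sub>R \<eta>)) (\<pi> a \<xi>)"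
      using vector_state by metis
    then show ?thesis unfolding k_def[symmetric] cinner_scaleR_left by blast
  qed
  obtain \<omega>1 where \<omega>1: "\<omega>1 \<in> invariant_states \<alpha>"
    "\<And>a. of_real (1 + t) * blinfun_apply \<omega>1 a = cinner (\<xi> + \<eta>) (\<pi> a \<xi>)"
    using state[of 1] t1 by (auto simp: of_real_divide simp del: of_real_add of_real_diff)
  obtain \<omega>2 where \<omega>2: "\<omega>2 \<in> invariant_states \<alpha>"
    "\<And>a. of_real (1 - t) * blinfun_apply \<omega>2 a = cinner (\<xi> - \<eta>) (\<pi> a \<xi>)"
    using state[of "-1"] t1 by (auto simp: of_real_divide simp del: of_real_add of_real_diff)
  \<comment> \<open>The weights \<open>(1 + t) / 2\<close> and \<open>(1 - t) / 2\<close> undo the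
    two normalisations, so that \<eta> cancels and \<omega> remains.\<close>
  define u where "u = (1 - t) / 2"
  have u: "0 < u" "u < 1" "2 * (1 - u) = 1 + t" "2 * u = 1 - t"
    using t1 by (auto simp: u_def field_simps)
  have "\<omega> = (1 - u) *\<^sub>R \<omega>1 + u *\<^sub>R \<omega>2"
  proof (rule blinfun_eqI)
    fix a
    have "2 * \<omega> a = cinner (\<xi> + \<eta>) (\<pi> a \<xi>) + cinner (\<xi> - \<eta>) (\<pi> a \<xi>)"
      by (simp add: cinner_add_left cinner_diff_left omega_gns)
    also have "\<dots> = of_real (2 * (1 - u)) * \<omega>1 a + of_real (2 * u) * \<omega>2 a"
      by (simp only: \<omega>1(2) \<omega>2(2) u(3,4))
    also have "\<dots> = 2 * ((1 - u) *\<^sub>R \<omega>1 + u *\<^sub>R \<omega>2) a"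
      by (simp add: blinfun.add_left blinfun.scaleR_left scaleR_conv_of_real distrib_left)
    finally show "\<omega> a = ((1 - u) *\<^sub>R \<omega>1 + u *\<^sub>R \<omega>2) a" by simp
  qed
  then have "\<omega>1 \<noteq> \<omega>2 \<Longrightarrow> \<omega> \<in> open_segment \<omega>1 \<omega>2"
    using u(1,2) by (auto simp: in_segment)
  then have eq: "\<omega>1 = \<omega>2"
    using ext \<omega>1(1) \<omega>2(1) unfolding extreme_point_of_def by blast
  \<comment> \<open>Equal states have equal representing vectors, because the orbit is dense;
    clearing the normalising denominators gives this equation for \<eta>.\<close>
  have "(1 - t) *\<^sub>R (\<xi> + \<eta>) = (1 + t) *\<^sub>R (\<xi> - \<eta>)"
  proof (rule cinner_eq_on_dense[OF orbit_dense])
    fix z assume "z \<in> range (\<lambda>a. \<pi> a \<xi>)"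
    then obtain a where z: "z = \<pi> a \<xi>" by blast
    show "cinner ((1 - t) *\<^sub>R (\<xi> + \<eta>)) z = cinner ((1 + t) *\<^sub>R (\<xi> - \<eta>)) z"
      unfolding cinner_scaleR_left z \<omega>1(2)[symmetric] \<omega>2(2)[symmetric] eq
      by (rule mult.left_commute)
  qed
  then have "\<eta> + \<eta> = t *\<^sub>R \<xi> + t *\<^sub>R \<xi>" by (simp add: algebra_simps)
  then have "2 *\<^sub>R \<eta> = 2 *\<^sub>R (t *\<^sub>R \<xi>)" by (simp only: scaleR_2)
  then have "\<eta> = t *\<^sub>R \<xi>" unfolding scaleR_cancel_left by simp
  then show ?thesis by (simp add: \<eta>_def t scaleC_of_real)
qed

text \<open>Both sides are complex linear in \<open>c\<close>: scaling removes the norm bound, and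
  the decomposition into real and imaginary parts removes self-adjointness.\<close>

lemma extreme_compression_even:
  assumes ext: "\<omega> extreme_point_of invariant_states \<alpha>" and c: "c \<in> even_local"
  shows "E (\<pi> c \<xi>) = \<omega> c *\<^sub>C \<xi>"
proof -
  note pos = invariant_state_positive[OF omega]
  have sa: "E (\<pi> h \<xi>) = \<omega> h *\<^sub>C \<xi>" if h: "h \<in> even_local" "star h = h" for h
  proof -
    \<comment> \<open>The added 1 gives the strict inequality \<open>norm h < r\<close> and keeps
      \<open>r\<close> positive when \<open>h = 0\<close>.\<close>
    define r where "r = norm h + 1"
    have r: "0 < r" "norm h < r" using norm_ge_zero[of h] by (auto simp: r_def simp del: norm_ge_zero)
    define k where "k = (1 / r) *\<^sub>R h"
    have "E (\<pi> k \<xi>) = \<omega> k *\<^sub>C \<xi>"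
    proof (rule extreme_compression_small[OF ext])
      show "k \<in> even_local" unfolding k_def by (rule subspace_scale[OF subspace_even_local h(1)])
      show "star k = k" by (simp add: k_def star_scaleR h(2))
      show "norm k < 1" using r by (simp add: k_def)
    qed
    moreover have "h = of_real r *\<^sub>C k" using r by (simp add: k_def scaleC_of_real)
    ultimately show ?thesis
      by (simp only: pi_scaleC E_scaleC positive_functional_scaleC[OF pos] scaleC_scaleC)
  qed
  define h where "h = (1/2) *\<^sub>C (c + star c)"
  define k where "k = (- \<i> / 2) *\<^sub>C (c - star c)"
  have "h \<in> even_local" "k \<in> even_local"
    unfolding h_def k_def using c even_local_star
    by (auto intro!: even_local_scaleC subspace_add[OF subspace_even_local]
        subspace_diff[OF subspace_even_local])
  moreover have "star h = h" by (simp add: h_def star_scaleC star_add star_star add.commute)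
  moreover have "star k = k"
  proof -
    have "star k = (\<i> / 2) *\<^sub>C (- (c - star c))"
      by (simp add: k_def star_scaleC star_diff star_star)
    also have "\<dots> = k" using scaleC_scaleC[of "\<i> / 2" "-1" "c - star c"] by (simp add: k_def)
    finally show ?thesis .
  qed
  moreover have "c = h + \<i> *\<^sub>C k"
  proof -
    have "h + \<i> *\<^sub>C k = (1/2) *\<^sub>C ((c + star c) + (c - star c))"
      unfolding h_def k_def scaleC_scaleC scaleC_add_right by simp
    also have "(c + star c) + (c - star c) = 2 *\<^sub>C c"
      using scaleC_add_left[of 1 1 c] by (simp add: scaleC_one)
    finally show ?thesis by (simp add: scaleC_scaleC scaleC_one)
  qed
  ultimately show ?thesis
    using sa[of h] sa[of k]
    by (simp add: pi_add pi_scaleC E_add E_scaleC positive_functional_add[OF pos]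
        positive_functional_scaleC[OF pos] scaleC_add_left scaleC_scaleC)
qed

text \<open>\<open>E\<close> turns out to be the rank one projection on \<xi>. Density is used
  twice, in the algebra and along the orbit; for odd local elements both sides vanish.\<close>

lemma extreme_imp_one_dim:
  assumes ext: "\<omega> extreme_point_of invariant_states \<alpha>"
  shows "F \<subseteq> range (\<lambda>c. c *\<^sub>C \<xi>)"
proof -
  have loc: "E (\<pi> a \<xi>) = \<omega> a *\<^sub>C \<xi>" if I: "finite I" "a \<in> \<AA> I" for a I
  proof -
    obtain b c where bc: "a = b + c" "b \<in> \<AA> I" "\<theta> b = b" "c \<in> \<AA> I" "\<theta> c = - c"
      using parity_decomposition[OF I] by metis
    have "b \<in> even_local" using bc local_algebraI[OF I(1)] by (simp add: even_local_def)
    then show ?thesis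
      using extreme_compression_even[OF ext] odd_compress[OF I(1) bc(4,5) cyclic_fixed]
        invariant_state_odd[OF omega I(1) bc(4,5)]
      by (simp add: bc(1) pi_add E_add blinfun.add_right)
  qed
  have "closed {a. E (\<pi> a \<xi>) = \<omega> a *\<^sub>C \<xi>}"
    by (rule closed_Collect_eq[OF
          linear_continuous_on[OF bounded_linear_compose[OF bounded_linear_E bounded_linear_pi]]
          linear_continuous_on[OF bounded_linear_compose[OF bounded_linear_scaleC_left
              blinfun.bounded_linear_right]]])
  then have "closure local_algebra \<subseteq> {a. E (\<pi> a \<xi>) = \<omega> a *\<^sub>C \<xi>}"
    by (rule closure_minimal[rotated]) (use loc in \<open>auto simp: local_algebra_def\<close>)
  then have "E (\<pi> a \<xi>) = cinner \<xi> (\<pi> a \<xi>) *\<^sub>C \<xi>" for a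
    by (auto simp: closure_local_algebra omega_gns)
  moreover have "closed {x. E x = cinner \<xi> x *\<^sub>C \<xi>}"
    by (rule closed_Collect_eq[OF linear_continuous_on[OF bounded_linear_E]
          linear_continuous_on[OF bounded_linear_compose[OF bounded_linear_scaleC_left
              bounded_linear_cinner_right]]])
  ultimately have "E x = cinner \<xi> x *\<^sub>C \<xi>" for x
    using orbit_induct[of "\<lambda>x. E x = cinner \<xi> x *\<^sub>C \<xi>"] by blast
  then show ?thesis using E_id by (metis rangeI subsetI)
qed

text \<open>\<open>cdim\<close> is 0 for spaces without a finite basis, so the value 1 does yield a
  singleton basis; its element is then rescaled to \<xi>, which is nonzero.\<close>

lemma cdim_fixed: "cdim F = 1 \<longleftrightarrow> F \<subseteq> range (\<lambda>c. c *\<^sub>C \<xi>)"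
proof -
  interpret vector_space "scaleC :: complex \<Rightarrow> 'h \<Rightarrow> 'h" by (rule vector_space_scaleC)
  have \<xi>0: "\<xi> \<noteq> 0" using norm_cyclic by auto
  show ?thesis
  proof
    assume dim: "dim F = 1"
    obtain B where B: "B \<subseteq> F" "independent B" "F \<subseteq> span B" "card B = dim F"
      by (rule basis_exists)
    then obtain x where x: "B = {x}" using dim by (metis card_1_singletonE)
    then have F: "F \<subseteq> range (\<lambda>c. c *\<^sub>C x)" using B(3) by (simp add: span_singleton)
    then obtain c where c: "\<xi> = c *\<^sub>C x" using cyclic_fixed by blast
    then have "c \<noteq> 0" using \<xi>0 by auto
    then have x: "x = inverse c *\<^sub>C \<xi>" by (simp add: c scaleC_scaleC scaleC_one)
    show "F \<subseteq> range (\<lambda>c. c *\<^sub>C \<xi>)"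
    proof
      fix y assume "y \<in> F"
      then obtain d where "y = d *\<^sub>C x" using F by blast
      then have "y = (d * inverse c) *\<^sub>C \<xi>" by (simp only: x scaleC_scaleC)
      then show "y \<in> range (\<lambda>c. c *\<^sub>C \<xi>)" by blast
    qed
  next
    assume "F \<subseteq> range (\<lambda>c. c *\<^sub>C \<xi>)"
    then have "F = span {\<xi>}"
      using fixed_scaleC[OF cyclic_fixed] by (auto simp: span_singleton)
    then show "dim F = 1" using \<xi>0 by (simp add: dim_eq_card_independent)
  qed
qed

end

theorem proposition2p4:
  fixes \<theta> :: "'a::unital_cstar_algebra \<Rightarrow> 'a"
    and \<AA> :: "nat set \<Rightarrow> 'a set"
    and \<alpha> :: "(nat \<Rightarrow> nat) \<Rightarrow> 'a \<Rightarrow> 'a"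
    and \<omega> :: "'a \<Rightarrow>\<^sub>L complex"
  assumes "local_action \<theta> \<AA> \<alpha>"
    and "\<omega> \<in> invariant_states \<alpha>"
  shows "blinfun_apply \<omega> \<circ> \<theta> = blinfun_apply \<omega> \<and>
    (\<forall>(\<pi> :: 'a \<Rightarrow> 'h::chilbert_space \<Rightarrow> 'h) \<xi>. gns_triple \<omega> \<pi> \<xi> \<longrightarrow>
      commuting_family (compressed_algebra \<alpha> \<pi> \<xi>)) \<and>
    perm_abelian TYPE('k::chilbert_space) \<alpha> \<and>
    (\<forall>(\<pi> :: 'a \<Rightarrow> 'h \<Rightarrow> 'h) \<xi>. gns_triple \<omega> \<pi> \<xi> \<longrightarrow>
      (\<omega> extreme_point_of invariant_states \<alpha> \<longleftrightarrow> cdim (fixed_vectors \<alpha> \<pi> \<xi>) = 1))"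
proof -
  interpret local_action \<theta> \<AA> \<alpha> by (rule assms(1))
  \<comment> \<open>The type variable \<open>'x\<close> is left open so that the fact applies to
    both Hilbert space types of the theorem.\<close>
  have gns: "invariant_gns \<theta> \<AA> \<alpha> \<omega>' \<pi> \<xi>"
    if "\<omega>' \<in> invariant_states \<alpha>" "gns_triple \<omega>' \<pi> \<xi>"
    for \<omega>' and \<pi> :: "'a \<Rightarrow> 'x::chilbert_space \<Rightarrow> 'x" and \<xi>
    using that by unfold_locales
  show ?thesis
    unfolding perm_abelian_def
  proof (intro conjI allI ballI impI)
    show "blinfun_apply \<omega> \<circ> \<theta> = blinfun_apply \<omega>" by (rule invariant_state_even[OF assms(2)])
    show "commuting_family (compressed_algebra \<alpha> \<pi> \<xi>)" if "gns_triple \<omega> \<pi> \<xi>"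
      for \<pi> :: "'a \<Rightarrow> 'h \<Rightarrow> 'h" and \<xi>
      by (rule invariant_gns.compressed_algebra_commuting[OF gns[OF assms(2) that]])
    show "commuting_family (compressed_algebra \<alpha> \<pi> \<xi>)"
      if "\<omega>' \<in> invariant_states \<alpha>" "gns_triple \<omega>' \<pi> \<xi>"
      for \<omega>' and \<pi> :: "'a \<Rightarrow> 'k \<Rightarrow> 'k" and \<xi>
      by (rule invariant_gns.compressed_algebra_commuting[OF gns[OF that]])
    show "\<omega> extreme_point_of invariant_states \<alpha> \<longleftrightarrow> cdim (fixed_vectors \<alpha> \<pi> \<xi>) = 1"
      if "gns_triple \<omega> \<pi> \<xi>" for \<pi> :: "'a \<Rightarrow> 'h \<Rightarrow> 'h" and \<xi>
    proof -
      interpret invariant_gns \<theta> \<AA> \<alpha> \<omega> \<pi> \<xi> by (rule gns[OF assms(2) that])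
      show ?thesis using extreme_if_one_dim extreme_imp_one_dim cdim_fixed by blast
    qed
  qed
qed
end
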